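(* Let $n\ge 5$ be an odd integer and let $D$ be the $(2n-1)\times(2n-1)$ distance matrix of the gear graph $G_n$ (described in the context). Then \[D^\dagger=-\frac12 L_{odd}+\frac{n-1}{2}uu',\] where \[u=\Big(\frac{-(3n-13)}{n^2+3n-4},\ \frac{-(n-6)}{n^2+3n-4}\mathbf{1}_{n-1}',\ \frac{1}{n+4}\mathbf{1}_{n-1}'\Big)'.\]
   Context: Notation: $\mathbf{1}_p$ is the all-ones column vector in $\mathbb{R}^p$, $J_p=\mathbf{1}_p\mathbf{1}_p'$, $I_p$ is the identity, $O$ a zero matrix; $X'$ is the transpose and $X^\dagger$ the Moore–Penrose inverse. $\mathrm{Circ}(a_1,\dots,a_p)$ is the $p\times p$ circulant matrix with first row $(a_1,\dots,a_p)$, each subsequent row being the previous one shifted cyclically one position to the right. Let $S=\mathrm{Circ}(1,3,\dots,3,1)$ (size $n-1$, with $n-3$ entries equal to $3$) and $T=\mathrm{Circ}(0,2,4,\dots,4,2)$ (size $n-1$, with $n-4$ entries equal to $4$). The gear graph $G_n$ is obtained from the wheel graph on $n$ vertices by inserting a new vertex on each edge of the outer cycle; with the center first, then the $n-1$ outer-cycle vertices in cyclic order, then the inserted vertices (the $i$-th lying between the $i$-th and $(i+1)$-th cycle vertices, cyclically), its distance matrix is \[D=\begin{bmatrix}0&\mathbf{1}_{n-1}'&2\mathbf{1}_{n-1}'\\ \mathbf{1}_{n-1}&2(J_{n-1}-I_{n-1})&S\\ 2\mathbf{1}_{n-1}&S'&T\end{bmatrix}.\] Let $\phi_k=\cos(\frac{\pi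 k}{n-1})$ for $k=1,\dots,n-2$ (note $\phi_{(n-1)/2}=0$), $C_k=\mathrm{Circ}(1,\cos\frac{2\pi k}{n-1},\dots,\cos\frac{2\pi(n-2)k}{n-1})$, $\widetilde{C_k}=\mathrm{Circ}(\cos\frac{2\pi k}{n-1},\dots,\cos\frac{2\pi(n-2)k}{n-1},1)$. Define \[A=\frac{9(n-1)}{(n+4)^2}\begin{bmatrix}1&\frac{n-2}{3(n-1)}\mathbf{1}_{n-1}'&\frac{-(n+1)}{3(n-1)}\mathbf{1}_{n-1}'\\ \frac{n-2}{3(n-1)}\mathbf{1}_{n-1}&\frac{(n-2)^2}{9(n-1)^2}J_{n-1}&\frac{-(n-2)(n+1)}{9(n-1)^2}J_{n-1}\\ \frac{-(n+1)}{3(n-1)}\mathbf{1}_{n-1}&\frac{-(n-2)(n+1)}{9(n-1)^2}J_{n-1}&\frac{(n+1)^2}{9(n-1)^2}J_{n-1}\end{bmatrix},\] for $k$ with $\phi_k\neq0$ \[B_k=\frac{2}{(n-1)(2\phi_k+\frac{1}{2\phi_k})^2}\begin{bmatrix}0&\mathbf{0}&\mathbf{0}\\ \mathbf{0}&\frac{C_k}{4\phi_k^2}&\frac{C_k+\widetilde{C_k}}{4\phi_k^2}\\ \mathbf{0}&\frac{C_k+\widetilde{C_k}'}{4\phi_k^2}&C_k\end{bmatrix},\] $H=\frac{1}{n-1}\begin{bmatrix}0&\mathbf{0}'&\mathbf{0}'\\ \mathbf{0}&R&O\\ \mathbf{0}&O&O\end{bmatrix}$ where $R$ is the $(n-1)\times(n-1)$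 matrix with $R(r,s)=(-1)^{r+s}$, and $L_{odd}=A+H+\sum_{k=1}^{(n-3)/2}B_k$. *)

theory Defs
  imports Complex_Main "Jordan_Normal_Form.Matrix"
begin

section \<open>The Moore--Penrose inverse of a real matrix\<close>

definition penrose_conditions :: "real mat \<Rightarrow> real mat \<Rightarrow> bool" where
  "penrose_conditions A X \<longleftrightarrow>
     X \<in> carrier_mat (dim_col A) (dim_row A) \<and>
     A * X * A = A \<and>
     X * A * X = X \<and>
     transpose_mat (A * X) = A * X \<and>
     transpose_mat (X * A) = X * A"

definition pinv :: "real mat \<Rightarrow> real mat" where
  "pinv A = (THE X. penrose_conditions A X)"

lemma penrose_unique:
  assumes "penrose_conditions A X" and "penrose_conditions A Y"
  shows "X = Y"
proof -
  obtain r c where A: "A \<in> carrier_mat r c" by blast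
  have X: "X \<in> carrier_mat c r" and Y: "Y \<in> carrier_mat c r"
    using assms A by (auto simp: penrose_conditions_def)
  have x: "A * X * A = A" "X * A * X = X"
      "transpose_mat (A * X) = A * X" "transpose_mat (X * A) = X * A"
    and y: "A * Y * A = A" "Y * A * Y = Y"
      "transpose_mat (A * Y) = A * Y" "transpose_mat (Y * A) = Y * A"
    using assms by (auto simp: penrose_conditions_def)
  have AX: "A * X \<in> carrier_mat r r" and AY: "A * Y \<in> carrier_mat r r"
    and XA: "X * A \<in> carrier_mat c c" and YA: "Y * A \<in> carrier_mat c c"
    using A X Y by auto
  have "A * X = transpose_mat (A * Y * A * X)" using x(3) y(1) by simp
  also have "\<dots> = transpose_mat ((A * Y) * (A * X))"
    using assoc_mult_mat[OF AY A X] by simp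
  also have "\<dots> = (A * X) * (A * Y)"
    using transpose_mult[OF AY AX] x(3) y(3) by simp
  also have "\<dots> = A * X * A * Y"
    using assoc_mult_mat[OF AX A Y] by simp
  finally have eq1: "A * X = A * Y" using x(1) by simp
  have "X * A = transpose_mat (X * (A * Y * A))" using x(4) y(1) by simp
  also have "\<dots> = transpose_mat ((X * A) * (Y * A))"
    using assoc_mult_mat[OF X A YA] assoc_mult_mat[OF A Y A] by simp
  also have "\<dots> = (Y * A) * (X * A)"
    using transpose_mult[OF XA YA] x(4) y(4) by simp
  also have "\<dots> = Y * (A * X * A)"
    using assoc_mult_mat[OF Y A XA] assoc_mult_mat[OF A X A] by simp
  finally have eq2: "X * A = Y * A" using x(1) by simp
  have "X = X * (A * X)" using x(2) assoc_mult_mat[OF X A X] by simp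
  also have "\<dots> = X * A * Y" using eq1 assoc_mult_mat[OF X A Y] by simp
  also have "\<dots> = Y" using eq2 y(2) by simp
  finally show ?thesis .
qed

lemma pinv_eqI: "penrose_conditions A X \<Longrightarrow> pinv A = X"
  unfolding pinv_def using penrose_unique by blast


section \<open>Block and circulant matrices\<close>

definition ones :: "nat \<Rightarrow> real mat" where
  "ones p = mat p 1 (\<lambda>_. 1)"

definition all_ones_mat :: "nat \<Rightarrow> real mat" where
  "all_ones_mat p = ones p * transpose_mat (ones p)"

definition scalar_mat :: "real \<Rightarrow> real mat" where
  "scalar_mat c = mat 1 1 (\<lambda>_. c)"

definition append_cols :: "real mat \<Rightarrow> real mat \<Rightarrow> real mat" where
  "append_cols A B = four_block_mat A B (0\<^sub>m 0 (dim_col A)) (0\<^sub>m 0 (dim_col B))"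

definition block3 ::
  "real mat \<Rightarrow> real mat \<Rightarrow> real mat \<Rightarrow>
   real mat \<Rightarrow> real mat \<Rightarrow> real mat \<Rightarrow>
   real mat \<Rightarrow> real mat \<Rightarrow> real mat \<Rightarrow> real mat" where
  "block3 A11 A12 A13
          A21 A22 A23
          A31 A32 A33 =
     four_block_mat A11 (append_cols A12 A13)
                    (A21 @\<^sub>r A31) (four_block_mat A22 A23 A32 A33)"

definition circ :: "real list \<Rightarrow> real mat" where
  "circ a = mat (length a) (length a)
     (\<lambda>(i, j). a ! ((j + length a - i) mod length a))"


section \<open>The gear graph and its distance matrix\<close>

text \<open>
  Vertex \<open>0\<close> is the center, \<open>1, \<dots>, n - 1\<close> are the cycle vertices in cyclic order, and
  \<open>n - 1 + i\<close> is the vertex inserted between the \<open>i\<close>-th cycle vertex and its cyclic successor.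
  The relation is symmetric, as the graph is undirected.
\<close>

definition gear_edges :: "nat \<Rightarrow> (nat \<times> nat) set" where
  "gear_edges n =
     (let E = (\<Union>i\<in>{1..n - 1}. {(0, i), (i, n - 1 + i), (i mod (n - 1) + 1, n - 1 + i)})
      in E \<union> E\<inverse>)"

text \<open>The least length of a walk; on disconnected vertices the value is unspecified.\<close>

definition graph_dist :: "('a \<times> 'a) set \<Rightarrow> 'a \<Rightarrow> 'a \<Rightarrow> nat" where
  "graph_dist E u v = (LEAST k. (u, v) \<in> E ^^ k)"

definition gear_dist_mat :: "nat \<Rightarrow> real mat" where
  "gear_dist_mat n =
     mat (2 * n - 1) (2 * n - 1) (\<lambda>(i, j). real (graph_dist (gear_edges n) i j))"

definition gear_S :: "nat \<Rightarrow> real mat" where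
  "gear_S n = circ ([1] @ replicate (n - 3) 3 @ [1])"

definition gear_T :: "nat \<Rightarrow> real mat" where
  "gear_T n = circ ([0, 2] @ replicate (n - 4) 4 @ [2])"

text \<open>
  The graph distances in closed form; \<open>next_cyc m\<close> is the cyclic successor on \<open>{1..m}\<close>.
\<close>

definition next_cyc :: "nat \<Rightarrow> nat \<Rightarrow> nat" where
  "next_cyc m i = (if i = m then 1 else i + 1)"

definition gear_d :: "nat \<Rightarrow> nat \<Rightarrow> nat \<Rightarrow> nat" where
  "gear_d m i j =
     (if i = j then 0
      else if i = 0 then (if j \<le> m then 1 else 2)
      else if j = 0 then (if i \<le> m then 1 else 2)
      else if i \<le> m \<and> j \<le> m then 2
      else if i \<le> m then (if i = j - m \<or> i = next_cyc m (j - m) then 1 else 3)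
      else if j \<le> m then (if j = i - m \<or> j = next_cyc m (i - m) then 1 else 3)
      else if i - m = next_cyc m (j - m) \<or> j - m = next_cyc m (i - m) then 2 else 4)"

lemma mod_next_cyc: "1 \<le> i \<Longrightarrow> i \<le> m \<Longrightarrow> i mod m + 1 = next_cyc m i"
  by (auto simp: next_cyc_def)

lemma gear_edges_iff:
  "(u, v) \<in> gear_edges n \<longleftrightarrow>
     (\<exists>i\<in>{1..n-1}. (u, v) \<in> {(0, i), (i, n-1+i), (next_cyc (n-1) i, n-1+i)} \<or>
                   (v, u) \<in> {(0, i), (i, n-1+i), (next_cyc (n-1) i, n-1+i)})"
proof -
  have "(\<Union>i\<in>{1..n - 1}. {(0, i), (i, n - 1 + i), (i mod (n - 1) + 1, n - 1 + i)}) =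
        (\<Union>i\<in>{1..n - 1}. {(0, i), (i, n - 1 + i), (next_cyc (n - 1) i, n - 1 + i)})"
    by (intro SUP_cong refl) (use mod_next_cyc in force)
  then show ?thesis
    unfolding gear_edges_def Let_def by (simp only: Un_iff converse_iff UN_iff bex_disj_distrib)
qed

lemma gear_edges_sym: "(u, v) \<in> gear_edges n \<Longrightarrow> (v, u) \<in> gear_edges n"
  unfolding gear_edges_iff by blast

lemma gear_edge_intros:
  assumes "1 \<le> i" "i \<le> n - 1"
  shows "(0, i) \<in> gear_edges n" "(i, n-1+i) \<in> gear_edges n" "(next_cyc (n-1) i, n-1+i) \<in> gear_edges n"
  using assms unfolding gear_edges_iff by (intro bexI[of _ i]; simp)+

lemma gear_vertex_cases:
  fixes s m :: nat
  assumes "s \<le> 2 * m"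
  obtains "s = 0" | "0 < s" "s \<le> m" | t where "s = m + t" "1 \<le> t" "t \<le> m"
proof -
  consider "s = 0" | "0 < s" "s \<le> m" | "m < s" by linarith
  then show ?thesis
  proof cases
    case 3
    then show ?thesis using assms by (intro that(3)[of "s - m"]) auto
  qed (use that in blast)+
qed

lemma gear_d_simps:
  assumes "m > 0"
  shows "gear_d m 0 0 = 0"
    and "0 < i \<Longrightarrow> i \<le> m \<Longrightarrow> gear_d m 0 i = 1"
    and "0 < i \<Longrightarrow> gear_d m 0 (m + i) = 2"
    and "0 < i \<Longrightarrow> i \<le> m \<Longrightarrow> gear_d m i 0 = 1"
    and "0 < i \<Longrightarrow> gear_d m (m + i) 0 = 2"
    and "0 < i \<Longrightarrow> i \<le> m \<Longrightarrow> 0 < j \<Longrightarrow> j \<le> m \<Longrightarrow> gear_d m i j = (if i = j then 0 else 2)"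
    and "0 < i \<Longrightarrow> i \<le> m \<Longrightarrow> 0 < j \<Longrightarrow> gear_d m i (m + j) = (if i = j \<or> i = next_cyc m j then 1 else 3)"
    and "0 < i \<Longrightarrow> i \<le> m \<Longrightarrow> 0 < j \<Longrightarrow> gear_d m (m + j) i = (if i = j \<or> i = next_cyc m j then 1 else 3)"
    and "0 < i \<Longrightarrow> 0 < j \<Longrightarrow> gear_d m (m + i) (m + j) =
           (if i = j then 0 else if i = next_cyc m j \<or> j = next_cyc m i then 2 else 4)"
  using assms by (auto simp: gear_d_def)

lemma gear_d_step:
  assumes n: "n \<ge> 4" and e: "(y, z) \<in> gear_edges n" and s: "s \<le> 2 * (n - 1)"
  shows "gear_d (n-1) s z \<le> gear_d (n-1) s y + 1"
proof -
  define m where "m = n - 1"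
  have m: "m \<ge> 3" using n m_def by simp
  from e have "\<exists>i\<in>{1..m}. (y, z) \<in> {(0, i), (i, m+i), (next_cyc m i, m+i)} \<or>
                          (z, y) \<in> {(0, i), (i, m+i), (next_cyc m i, m+i)}"
    unfolding gear_edges_iff m_def .
  then obtain i where i': "i \<in> {1..m}"
    and yz: "(y, z) \<in> {(0, i), (i, m+i), (next_cyc m i, m+i)} \<or>
             (z, y) \<in> {(0, i), (i, m+i), (next_cyc m i, m+i)}"
    by (rule bexE)
  then have i: "1 \<le> i" "i \<le> m" by auto
  have s': "s \<le> 2 * m" using s m_def by simp
  have c: "0 < next_cyc m i" "next_cyc m i \<le> m" using i by (auto simp: next_cyc_def)
  have mono: "gear_d m s a \<le> gear_d m s b + 1 \<and> gear_d m s b \<le> gear_d m s a + 1"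
    if ab: "(a, b) \<in> {(0, i), (i, m+i), (next_cyc m i, m+i)}" for a b
    using s'
  proof (cases rule: gear_vertex_cases)
    case 1
    then show ?thesis using ab c i m by (auto simp: gear_d_simps)
  next
    case 2
    then show ?thesis using ab c i m by (auto simp: gear_d_simps)
  next
    case t: (3 t)
    have inj: "next_cyc m i = next_cyc m t \<longleftrightarrow> i = t"
      using i t by (auto simp: next_cyc_def split: if_splits)
    have "gear_d m s 0 = 2"
      "gear_d m s i = (if i = t \<or> i = next_cyc m t then 1 else 3)"
      "gear_d m s (next_cyc m i) = (if next_cyc m i = t \<or> i = t then 1 else 3)"
      "gear_d m s (m + i) = (if t = i then 0 else if t = next_cyc m i \<or> i = next_cyc m t then 2 else 4)"
      using t i c m inj by (simp_all add: gear_d_simps)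
    then show ?thesis using ab by (elim insertE emptyE) simp_all
  qed
  then show ?thesis using yz mono unfolding m_def by metis
qed

lemma relpow_two: "(x, y) \<in> E \<Longrightarrow> (y, z) \<in> E \<Longrightarrow> (x, z) \<in> E ^^ 2"
  by (auto simp: numeral_2_eq_2)

lemma gear_to_center:
  assumes "i \<noteq> 0" "i \<le> 2 * (n - 1)"
  shows "(i, 0) \<in> gear_edges n ^^ (if i \<le> n - 1 then 1 else 2)"
proof (cases "i \<le> n - 1")
  case True
  then show ?thesis using gear_edge_intros(1)[of i n] assms gear_edges_sym by auto
next
  case False
  then have "(i - (n-1), i) \<in> gear_edges n" "(0, i - (n-1)) \<in> gear_edges n"
    using gear_edge_intros[of "i - (n-1)" n] assms by auto
  then show ?thesis using False relpow_two gear_edges_sym by (metis (full_types))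
qed

lemma relpow_gear_sym: "(u, v) \<in> gear_edges n ^^ k \<Longrightarrow> (v, u) \<in> gear_edges n ^^ k"
proof (induction k arbitrary: v)
  case (Suc k)
  then obtain w where "(u, w) \<in> gear_edges n ^^ k" "(w, v) \<in> gear_edges n" by auto
  then show ?case using Suc.IH gear_edges_sym relpow_Suc_I2 by metis
qed auto

lemma gear_d_walk:
  assumes n: "n \<ge> 4" and i: "i \<le> 2 * (n - 1)" and j: "j \<le> 2 * (n - 1)"
  shows "(i, j) \<in> gear_edges n ^^ gear_d (n-1) i j"
proof -
  let ?E = "gear_edges n"
  define m where "m = n - 1"
  have m: "m > 0" and i': "i \<le> 2 * m" and j': "j \<le> 2 * m" using n i j m_def by auto
  have adj: "(a, m + b) \<in> ?E \<and> (m + b, a) \<in> ?E"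
    if "0 < b" "b \<le> m" "a = b \<or> a = next_cyc m b" for a b
  proof -
    have "1 \<le> b" "b \<le> n - 1" using that m_def by auto
    note e = gear_edge_intros(2,3)[OF this, folded m_def]
    show ?thesis using that(3) e e[THEN gear_edges_sym] by metis
  qed
  have via_center: "(i, j) \<in> ?E ^^ ((if i \<le> m then 1 else 2) + (if j \<le> m then 1 else 2))"
    if "i \<noteq> 0" "j \<noteq> 0"
    using gear_to_center[OF that(1) i] relpow_gear_sym[OF gear_to_center[OF that(2) j]]
    unfolding relpow_add m_def by blast
  have "(i, j) \<in> ?E ^^ gear_d m i j"
  proof (cases "i = j \<or> i = 0 \<or> j = 0")
    case True
    then consider "i = j" | "i = 0" "j \<noteq> 0" | "j = 0" "i \<noteq> 0" by metis
    then show ?thesis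
    proof cases
      case 1
      then show ?thesis by (simp add: gear_d_def)
    next
      case 2
      then have "gear_d m i j = (if j \<le> n - 1 then 1 else 2)" by (simp add: gear_d_def m_def)
      then show ?thesis using relpow_gear_sym[OF gear_to_center[OF 2(2) j]] 2(1) by metis
    next
      case 3
      then have "gear_d m i j = (if i \<le> n - 1 then 1 else 2)" by (simp add: gear_d_def m_def)
      then show ?thesis using gear_to_center[OF 3(2) i] 3(1) by metis
    qed
  next
    case False
    show ?thesis
      using i'
    proof (cases rule: gear_vertex_cases)
      case 1
      then show ?thesis using False by simp
    next
      case i: 2
      show ?thesis using j'
      proof (cases rule: gear_vertex_cases)
        case 1
        then show ?thesis using False by simp
      next
        case 2
        then have "gear_d m i j = 1 + 1" using False i m by (simp add: gear_d_simps)
        then show ?thesis using via_center False i 2 by metis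
      next
        case (3 t)
        show ?thesis
        proof (cases "i = t \<or> i = next_cyc m t")
          case True
          then have "gear_d m i j = 1" using i 3 m by (simp add: gear_d_simps)
          then show ?thesis using adj[of t i] 3 True by simp
        next
          case nn: False
          then have "gear_d m i j = 1 + 2" "\<not> j \<le> m" using i 3 m by (simp_all add: gear_d_simps)
          then show ?thesis using via_center False i by metis
        qed
      qed
    next
      case i: (3 s)
      show ?thesis using j'
      proof (cases rule: gear_vertex_cases)
        case 1
        then show ?thesis using False by simp
      next
        case 2
        show ?thesis
        proof (cases "j = s \<or> j = next_cyc m s")
          case True
          then have "gear_d m i j = 1" using i 2 m by (simp add: gear_d_simps)
          then show ?thesis using adj[of s j] i True by simp
        next
          case nn: False
          then have "gear_d m i j = 2 + 1" "\<not> i \<le> m" using i 2 m by (simp_all add: gear_d_simps)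
          then show ?thesis using via_center False 2 by metis
        qed
      next
        case (3 t)
        have two: "(i, j) \<in> ?E ^^ 2" if "s = next_cyc m t \<or> t = next_cyc m s"
        proof -
          have st: "0 < s" "0 < t" using i(2) 3(2) by linarith+
          have "\<exists>a. (i, a) \<in> ?E \<and> (a, j) \<in> ?E"
            using that
          proof
            assume "s = next_cyc m t"
            then show ?thesis
              using adj[OF st(1) i(3), of s] adj[OF st(2) 3(3), of s] i(1) 3(1) by blast
          next
            assume "t = next_cyc m s"
            then show ?thesis
              using adj[OF st(1) i(3), of t] adj[OF st(2) 3(3), of t] i(1) 3(1) by blast
          qed
          then show ?thesis using relpow_two by metis
        qed
        show ?thesis
        proof (cases "s = next_cyc m t \<or> t = next_cyc m s")
          case True
          then have "gear_d m i j = 2" using False i 3 m by (auto simp: gear_d_simps)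
          then show ?thesis using two[OF True] by simp
        next
          case nn: False
          then have "gear_d m i j = 2 + 2" "\<not> i \<le> m" "\<not> j \<le> m"
            using False i 3 m by (simp_all add: gear_d_simps)
          then show ?thesis using via_center False by metis
        qed
      qed
    qed
  qed
  then show ?thesis unfolding m_def .
qed

lemma graph_dist_gear:
  assumes n: "n \<ge> 4" and i: "i \<le> 2 * (n - 1)" and j: "j \<le> 2 * (n - 1)"
  shows "graph_dist (gear_edges n) i j = gear_d (n-1) i j"
  unfolding graph_dist_def
proof (rule Least_equality)
  show "(i, j) \<in> gear_edges n ^^ gear_d (n-1) i j" by (rule gear_d_walk[OF n i j])
  fix k assume "(i, j) \<in> gear_edges n ^^ k"
  then show "gear_d (n-1) i j \<le> k"
  proof (induction k arbitrary: j)
    case 0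
    then show ?case by (simp add: gear_d_def)
  next
    case (Suc k)
    then obtain w where "(i, w) \<in> gear_edges n ^^ k" "(w, j) \<in> gear_edges n" by auto
    then show ?case using Suc.IH gear_d_step[OF n _ i, of w j] by fastforce
  qed
qed

lemma cyc_diff: "i < m \<Longrightarrow> j < m \<Longrightarrow> (j + m - i) mod m = (if i \<le> j then j - i else j + m - i)"
  for i j m :: nat
proof -
  assume a: "i < m" "j < m"
  show ?thesis
  proof (cases "i \<le> j")
    case True
    then have "j + m - i = (j - i) + m" by simp
    then have "(j + m - i) mod m = (j - i) mod m" by (simp only: mod_add_self2)
    then show ?thesis using a True by (simp add: less_imp_diff_less)
  qed (use a in simp)
qed

lemma block3_entry:
  assumes "A11 \<in> carrier_mat 1 1" "A12 \<in> carrier_mat 1 m" "A13 \<in> carrier_mat 1 m"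
    "A21 \<in> carrier_mat m 1" "A22 \<in> carrier_mat m m" "A23 \<in> carrier_mat m m"
    "A31 \<in> carrier_mat m 1" "A32 \<in> carrier_mat m m" "A33 \<in> carrier_mat m m"
  shows "block3 A11 A12 A13 A21 A22 A23 A31 A32 A33 \<in> carrier_mat (1 + 2 * m) (1 + 2 * m)"
    and "i < 1 + 2 * m \<Longrightarrow> j < 1 + 2 * m \<Longrightarrow>
      block3 A11 A12 A13 A21 A22 A23 A31 A32 A33 $$ (i, j) =
      (if i = 0 then
         (if j = 0 then A11 $$ (0, 0) else if j \<le> m then A12 $$ (0, j - 1) else A13 $$ (0, j - 1 - m))
       else if i \<le> m then
         (if j = 0 then A21 $$ (i - 1, 0) else if j \<le> m then A22 $$ (i - 1, j - 1) else A23 $$ (i - 1, j - 1 - m))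
       else
         (if j = 0 then A31 $$ (i - 1 - m, 0) else if j \<le> m then A32 $$ (i - 1 - m, j - 1)
          else A33 $$ (i - 1 - m, j - 1 - m)))" (is "_ \<Longrightarrow> _ \<Longrightarrow> ?eq")
proof -
  note d = assms[THEN carrier_matD(1)] assms[THEN carrier_matD(2)]
  show "block3 A11 A12 A13 A21 A22 A23 A31 A32 A33 \<in> carrier_mat (1 + 2 * m) (1 + 2 * m)"
    by (rule carrier_matI) (simp_all add: block3_def d)
  assume "i < 1 + 2 * m" "j < 1 + 2 * m"
  moreover have "k - Suc 0 < m \<longleftrightarrow> k \<le> m" if "0 < k" for k using that by auto
  ultimately show ?eq
    by (cases "i = 0"; cases "j = 0"; cases "i \<le> m"; cases "j \<le> m")
       (simp_all add: block3_def append_cols_def append_rows_def d)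
qed

lemma nth_S_list:
  "q < p + 2 \<Longrightarrow> ([1] @ replicate p 3 @ [1 :: real]) ! q = (if q = 0 \<or> q = p + 1 then 1 else 3)"
  by (auto simp: nth_append nth_Cons')

lemma nth_T_list:
  "q < p + 3 \<Longrightarrow> ([0, 2] @ replicate p 4 @ [2 :: real]) ! q =
     (if q = 0 then 0 else if q = 1 \<or> q = p + 2 then 2 else 4)"
  by (auto simp: nth_append nth_Cons')

lemma gear_S_entry:
  assumes "m \<ge> 3" "i < m" "j < m"
  shows "gear_S (Suc m) $$ (i, j) = (if i = j \<or> Suc i = next_cyc m (Suc j) then 1 else 3)"
proof -
  have len: "length ([1] @ replicate (Suc m - 3) 3 @ [1 :: real]) = m" using assms by auto
  have "gear_S (Suc m) $$ (i, j) =
      ([1] @ replicate (Suc m - 3) 3 @ [1 :: real]) ! ((j + m - i) mod m)"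
    unfolding gear_S_def circ_def len using assms by simp
  also have "\<dots> = (if (j + m - i) mod m = 0 \<or> (j + m - i) mod m = m - 1 then 1 else 3)"
  proof (subst nth_S_list)
    have "(j + m - i) mod m < m" using assms by simp
    then show "(j + m - i) mod m < Suc m - 3 + 2" using assms by linarith
  qed (use assms in auto)
  also have "\<dots> = (if i = j \<or> Suc i = next_cyc m (Suc j) then 1 else 3)"
    unfolding cyc_diff[OF assms(2,3)] next_cyc_def using assms by (auto split: if_splits)
  finally show ?thesis .
qed

lemma gear_T_entry:
  assumes "m \<ge> 3" "i < m" "j < m"
  shows "gear_T (Suc m) $$ (i, j) =
    (if i = j then 0
     else if Suc i = next_cyc m (Suc j) \<or> Suc j = next_cyc m (Suc i) then 2 else 4)"
proof -
  have len: "length ([0, 2] @ replicate (Suc m - 4) 4 @ [2 :: real]) = m" using assms by auto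
  have "gear_T (Suc m) $$ (i, j) =
      ([0, 2] @ replicate (Suc m - 4) 4 @ [2 :: real]) ! ((j + m - i) mod m)"
    unfolding gear_T_def circ_def len using assms by simp
  also have "\<dots> = (if (j + m - i) mod m = 0 then 0
      else if (j + m - i) mod m = 1 \<or> (j + m - i) mod m = m - 1 then 2 else 4)"
  proof (subst nth_T_list)
    have "(j + m - i) mod m < m" using assms by simp
    then show "(j + m - i) mod m < Suc m - 4 + 3" using assms by linarith
    have "Suc m - 4 + 2 = m - 1" using assms by linarith
    then show "(if (j + m - i) mod m = 0 then 0
        else if (j + m - i) mod m = 1 \<or> (j + m - i) mod m = Suc m - 4 + 2 then 2 else 4) =
      (if (j + m - i) mod m = 0 then 0
        else if (j + m - i) mod m = 1 \<or> (j + m - i) mod m = m - 1 then 2 else (4 :: real))"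
      by (simp only:)
  qed
  also have "\<dots> = (if i = j then 0
     else if Suc i = next_cyc m (Suc j) \<or> Suc j = next_cyc m (Suc i) then 2 else 4)"
  proof -
    consider "i = j" | "i < j" | "j < i" by linarith
    then show ?thesis
    proof cases
      case 1
      then show ?thesis using assms by simp
    next
      case 2
      then have "j - i = 1 \<longleftrightarrow> Suc j = next_cyc m (Suc i)" "j - i = m - 1 \<longleftrightarrow> Suc i = next_cyc m (Suc j)"
        using assms unfolding next_cyc_def by (simp; linarith)+
      moreover have "(j + m - i) mod m = j - i" using 2 cyc_diff[OF assms(2,3)] by simp
      ultimately show ?thesis using 2 by auto
    next
      case 3
      then have "j + m - i = 1 \<longleftrightarrow> Suc j = next_cyc m (Suc i)" "j + m - i = m - 1 \<longleftrightarrow> Suc i = next_cyc m (Suc j)"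
        using assms unfolding next_cyc_def by (simp; linarith)+
      moreover have "(j + m - i) mod m = j + m - i" using 3 cyc_diff[OF assms(2,3)] by simp
      ultimately show ?thesis using 3 assms by auto
    qed
  qed
  finally show ?thesis .
qed

lemma gear_dist_mat_block:
  assumes n: "n \<ge> 4"
  shows "gear_dist_mat n =
    block3 (scalar_mat 0)           (transpose_mat (ones (n-1)))                       (2 \<cdot>\<^sub>m transpose_mat (ones (n-1)))
           (ones (n-1))             (2 \<cdot>\<^sub>m (all_ones_mat (n-1) - 1\<^sub>m (n-1)))  (gear_S n)
           (2 \<cdot>\<^sub>m ones (n-1))  (transpose_mat (gear_S n))                         (gear_T n)"
    (is "_ = ?B")
proof -
  define m where "m = n - 1"
  have m: "m > 0" and m3: "m \<ge> 3" and nm: "n = Suc m" using n m_def by auto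
  have S: "gear_S n \<in> carrier_mat m m" and T: "gear_T n \<in> carrier_mat m m"
    using m3 by (auto simp: gear_S_def gear_T_def circ_def nm)
  have J: "all_ones_mat m = mat m m (\<lambda>_. 1)"
    by (rule eq_matI) (auto simp: all_ones_mat_def ones_def scalar_prod_def)
  let ?B' = "block3 (scalar_mat 0) (transpose_mat (ones m)) (2 \<cdot>\<^sub>m transpose_mat (ones m))
           (ones m) (2 \<cdot>\<^sub>m (all_ones_mat m - 1\<^sub>m m)) (gear_S n)
           (2 \<cdot>\<^sub>m ones m) (transpose_mat (gear_S n)) (gear_T n)"
  have carr: "scalar_mat 0 \<in> carrier_mat 1 1" "transpose_mat (ones m) \<in> carrier_mat 1 m"
      "2 \<cdot>\<^sub>m transpose_mat (ones m) \<in> carrier_mat 1 m"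
      "ones m \<in> carrier_mat m 1" "2 \<cdot>\<^sub>m (all_ones_mat m - 1\<^sub>m m) \<in> carrier_mat m m"
      "gear_S n \<in> carrier_mat m m" "2 \<cdot>\<^sub>m ones m \<in> carrier_mat m 1"
      "transpose_mat (gear_S n) \<in> carrier_mat m m" "gear_T n \<in> carrier_mat m m"
    using S T by (auto simp: scalar_mat_def ones_def J)
  note B_carrier = block3_entry(1)[OF carr] and B_entry = block3_entry(2)[OF carr]
  have "gear_dist_mat n = ?B'"
  proof (rule eq_matI)
    show "dim_row (gear_dist_mat n) = dim_row ?B'" "dim_col (gear_dist_mat n) = dim_col ?B'"
      using carrier_matD[OF B_carrier] by (auto simp: gear_dist_mat_def nm)
    fix i j assume "i < dim_row ?B'" "j < dim_col ?B'"
    then have i: "i \<le> 2 * m" and j: "j \<le> 2 * m" using carrier_matD[OF B_carrier] by auto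
    have "gear_dist_mat n $$ (i, j) = real (gear_d m i j)"
      using i j graph_dist_gear[OF n, of i j] by (simp add: gear_dist_mat_def nm)
    also have "\<dots> = ?B' $$ (i, j)"
    proof -
      have Se: "gear_S n $$ (a - 1, b - 1) = (if a = b \<or> a = next_cyc m b then 1 else 3)"
        if "0 < a" "a \<le> m" "0 < b" "b \<le> m" for a b
        using gear_S_entry[OF m3, of "a - 1" "b - 1"] that nm by (simp add: eq_diff_iff)
      have Te: "gear_T n $$ (a - 1, b - 1) =
          (if a = b then 0 else if a = next_cyc m b \<or> b = next_cyc m a then 2 else 4)"
        if "0 < a" "a \<le> m" "0 < b" "b \<le> m" for a b
        using gear_T_entry[OF m3, of "a - 1" "b - 1"] that nm by (simp add: eq_diff_iff)
      have St: "transpose_mat (gear_S n) $$ (b - 1, a - 1) = (if a = b \<or> a = next_cyc m b then 1 else 3)"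
        if "0 < a" "a \<le> m" "0 < b" "b \<le> m" for a b
        using Se[OF that] S that by simp
      have cancel: "m + t - 1 - m = t - 1" for t by simp
      have ij: "i < 1 + 2 * m" "j < 1 + 2 * m" using i j by auto
      note Be = B_entry[OF ij]
      show ?thesis
        using i
      proof (cases rule: gear_vertex_cases)
        case i: 1
        show ?thesis using j unfolding Be
          by (cases rule: gear_vertex_cases) (use i m in \<open>auto simp: gear_d_simps scalar_mat_def ones_def\<close>)
      next
        case i: 2
        show ?thesis using j unfolding Be
          by (cases rule: gear_vertex_cases)
             (use i m in \<open>auto simp: gear_d_simps ones_def J cancel Se simp del: One_nat_def\<close>)
      next
        case i: (3 s)
        show ?thesis using j unfolding Be
          by (cases rule: gear_vertex_cases)
             (use i m in \<open>auto simp: gear_d_simps ones_def cancel St Te simp del: One_nat_def\<close>)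
      qed
    qed
    finally show "gear_dist_mat n $$ (i, j) = ?B' $$ (i, j)" .
  qed
  then show ?thesis unfolding m_def .
qed


section \<open>The matrix \<open>L_odd\<close> and the vector \<open>u\<close>\<close>

definition phi :: "nat \<Rightarrow> nat \<Rightarrow> real" where
  "phi n k = cos (pi * real k / (real n - 1))"

definition cos_entries :: "nat \<Rightarrow> nat \<Rightarrow> real list" where
  "cos_entries n k = map (\<lambda>j. cos (2 * pi * real j * real k / (real n - 1))) [1..<n - 1]"

definition C_mat :: "nat \<Rightarrow> nat \<Rightarrow> real mat" where
  "C_mat n k = circ (1 # cos_entries n k)"

definition C_tilde :: "nat \<Rightarrow> nat \<Rightarrow> real mat" where
  "C_tilde n k = circ (cos_entries n k @ [1])"

definition A_mat :: "nat \<Rightarrow> real mat" where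
  "A_mat n =
    (let x = real n; e = ones (n - 1); J = all_ones_mat (n - 1);
         a = (x - 2) / (3 * (x - 1)); b = - (x + 1) / (3 * (x - 1))
     in (9 * (x - 1) / (x + 4)\<^sup>2) \<cdot>\<^sub>m
        block3
          (scalar_mat 1)   (a \<cdot>\<^sub>m transpose_mat e)                                 (b \<cdot>\<^sub>m transpose_mat e)
          (a \<cdot>\<^sub>m e)  (((x - 2)\<^sup>2 / (9 * (x - 1)\<^sup>2)) \<cdot>\<^sub>m J)         ((- (x - 2) * (x + 1) / (9 * (x - 1)\<^sup>2)) \<cdot>\<^sub>m J)
          (b \<cdot>\<^sub>m e)  ((- (x - 2) * (x + 1) / (9 * (x - 1)\<^sup>2)) \<cdot>\<^sub>m J)  (((x + 1)\<^sup>2 / (9 * (x - 1)\<^sup>2)) \<cdot>\<^sub>m J))"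

definition B_mat :: "nat \<Rightarrow> nat \<Rightarrow> real mat" where
  "B_mat n k =
    (let m = n - 1; f = phi n k; C = C_mat n k; C' = C_tilde n k
     in (2 / ((real n - 1) * (2 * f + 1 / (2 * f))\<^sup>2)) \<cdot>\<^sub>m
        block3
          (0\<^sub>m 1 1)  (0\<^sub>m 1 m)                                               (0\<^sub>m 1 m)
          (0\<^sub>m m 1)  ((1 / (4 * f\<^sup>2)) \<cdot>\<^sub>m C)                         ((1 / (4 * f\<^sup>2)) \<cdot>\<^sub>m (C + C'))
          (0\<^sub>m m 1)  ((1 / (4 * f\<^sup>2)) \<cdot>\<^sub>m (C + transpose_mat C'))   C)"

text \<open>Zero-based indices give the same sign \<open>(-1)^(r+s)\<close> as one-based ones.\<close>

definition R_mat :: "nat \<Rightarrow> real mat" where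
  "R_mat n = mat (n - 1) (n - 1) (\<lambda>(r, s). (- 1) ^ (r + s))"

definition H_mat :: "nat \<Rightarrow> real mat" where
  "H_mat n =
    (let m = n - 1
     in (1 / (real n - 1)) \<cdot>\<^sub>m
        block3
          (0\<^sub>m 1 1)  (0\<^sub>m 1 m)  (0\<^sub>m 1 m)
          (0\<^sub>m m 1)  (R_mat n)        (0\<^sub>m m m)
          (0\<^sub>m m 1)  (0\<^sub>m m m)  (0\<^sub>m m m))"

definition L_odd :: "nat \<Rightarrow> real mat" where
  "L_odd n = A_mat n + H_mat n +
     mat (2 * n - 1) (2 * n - 1) (\<lambda>ij. \<Sum>k = 1..(n - 3) div 2. B_mat n k $$ ij)"

definition u_vec :: "nat \<Rightarrow> real mat" where
  "u_vec n =
    (let x = real n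
     in scalar_mat (- (3 * x - 13) / (x\<^sup>2 + 3 * x - 4)) @\<^sub>r
        ((- (x - 6) / (x\<^sup>2 + 3 * x - 4)) \<cdot>\<^sub>m ones (n - 1)) @\<^sub>r
        ((1 / (x + 4)) \<cdot>\<^sub>m ones (n - 1)))"

end

theory Submission
  imports Defs
begin

text \<open>
  Put \<open>m = n - 1\<close> and let \<open>E\<close> be the \<open>m \<times> (2m + 1)\<close> matrix whose column at a vertex is zero for the
  center, a unit vector for a cycle vertex, and the sum of the unit vectors of its two neighbours for
  an inserted vertex. With \<open>g = (0, 1, 2)\<close> blockwise, \<open>D = g 1' + 1 g' - 2 E' E\<close>. Splitting off the
  constant mode by \<open>P = I - J / m\<close>, and using \<open>E' 1 = g\<close>, this becomes \<open>D = - 2 E' P E + Y\<close>, where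
  \<open>Y = g 1' + 1 g' - (2 / m) g g'\<close> is constant on blocks and orthogonal to the first summand.
  The pseudoinverse may therefore be computed summand by summand. That of \<open>E' P E\<close> is \<open>E' K E\<close>, where
  \<open>K\<close> inverts \<open>(E E')^2\<close> off the constant mode; written in the Fourier basis of the cycle it is
  \<open>H + \<Sum> B_k\<close>. That of \<open>Y\<close> is a computation with 3 by 3 matrices and accounts for \<open>A\<close> and \<open>u\<close>.
\<close>

section \<open>Moore--Penrose inverses of sums\<close>

text \<open>For symmetric commuting factors \<open>(A * X)' = X' * A' = X * A = A * X\<close>, so
  commutation yields both symmetry conditions at once.\<close>

lemma penrose_symmetric:
  assumes "A \<in> carrier_mat N N" "X \<in> carrier_mat N N"
    and "transpose_mat A = A" "transpose_mat X = X"
    and "A * X = X * A" "A * X * A = A" "X * A * X = X"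
  shows "penrose_conditions A X"
  using assms by (auto simp: penrose_conditions_def transpose_mult[of _ N N _ N])

lemma penrose_smult:
  assumes "penrose_conditions A X" "c \<noteq> 0"
  shows "penrose_conditions (c \<cdot>\<^sub>m A) ((1 / c) \<cdot>\<^sub>m X)"
proof -
  obtain r q where A: "A \<in> carrier_mat r q" by blast
  then have X: "X \<in> carrier_mat q r" using assms by (auto simp: penrose_conditions_def)
  have AX: "(c \<cdot>\<^sub>m A) * ((1 / c) \<cdot>\<^sub>m X) = A * X" and XA: "((1 / c) \<cdot>\<^sub>m X) * (c \<cdot>\<^sub>m A) = X * A"
    using A X assms(2)
    by (auto simp: mult_smult_assoc_mat[of _ r q _ r] mult_smult_distrib[of _ r q _ r]
       mult_smult_assoc_mat[of _ q r _ q] mult_smult_distrib[of _ q r _ q] intro!: eq_matI)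
  show ?thesis
    using A X assms(1) unfolding penrose_conditions_def AX XA
    by (auto simp: mult_smult_distrib[of _ r r _ q] mult_smult_distrib[of _ q q _ r])
qed

text \<open>All cross terms vanish, so \<open>(A + B) * (X + Y)\<close> reduces to
  \<open>A * X + B * Y\<close>, and each condition splits into one for each summand.\<close>

lemma penrose_add_orthogonal:
  assumes c: "A \<in> carrier_mat N N" "X \<in> carrier_mat N N" "B \<in> carrier_mat N N" "Y \<in> carrier_mat N N"
    and p: "penrose_conditions A X" "penrose_conditions B Y"
    and z: "A * Y = 0\<^sub>m N N" "Y * A = 0\<^sub>m N N" "B * X = 0\<^sub>m N N" "X * B = 0\<^sub>m N N"
  shows "penrose_conditions (A + B) (X + Y)"
proof -
  have AX: "(A + B) * (X + Y) = A * X + B * Y" and XA: "(X + Y) * (A + B) = X * A + Y * B"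
    using c z by (auto simp: add_mult_distrib_mat[of _ N N _ _ N] mult_add_distrib_mat[of _ N N _ N])
  have "B * Y * A = 0\<^sub>m N N" "A * X * B = 0\<^sub>m N N" "X * A * Y = 0\<^sub>m N N" "Y * B * X = 0\<^sub>m N N"
    using c z by (simp_all add: assoc_mult_mat[of _ N N _ N _ N])
  then show ?thesis
    using c p unfolding penrose_conditions_def AX XA
    by (auto simp: add_mult_distrib_mat[of _ N N _ _ N] mult_add_distrib_mat[of _ N N _ N]
       transpose_add[of _ N N])
qed

text \<open>In a product, adjacent factors \<open>E\<close> and \<open>E'\<close> merge into
  \<open>W = E E'\<close>, so the conditions for the large matrices follow from identities between
  \<open>m\<close> by \<open>m\<close> matrices.\<close>

lemma penrose_sandwich:
  assumes c: "E \<in> carrier_mat m N" "P \<in> carrier_mat m m" "K \<in> carrier_mat m m"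
    and s: "transpose_mat P = P" "transpose_mat K = K"
    and W: "W = E * transpose_mat E"
    and comm: "P * W * K = K * W * P"
    and "P * W * K * W * P = P" "K * W * P * W * K = K"
  shows "penrose_conditions (transpose_mat E * P * E) (transpose_mat E * K * E)"
proof -
  let ?T = "transpose_mat E"
  have T: "?T \<in> carrier_mat N m" and Wc: "W \<in> carrier_mat m m" using c W by auto
  have sw: "(?T * Q * E) * (?T * R * E) = ?T * (Q * W * R) * E"
    if "Q \<in> carrier_mat m m" "R \<in> carrier_mat m m" for Q R
  proof -
    have "(?T * Q * E) * (?T * R * E) = ?T * (Q * (E * ?T) * R) * E"
      using that c(1) T
      by (simp add: assoc_mult_mat[of _ N m _ m _ N] assoc_mult_mat[of _ N m _ N _ N]
         assoc_mult_mat[of _ N m _ m _ m] assoc_mult_mat[of _ m m _ m _ N] assoc_mult_mat[of _ m N _ m _ m]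
         assoc_mult_mat[of _ m N _ m _ N] assoc_mult_mat[of _ m m _ N _ N] assoc_mult_mat[of _ m m _ m _ m]
         assoc_mult_mat[of _ m m _ N _ m])
    then show ?thesis using W by simp
  qed
  have sym: "transpose_mat (?T * Q * E) = ?T * Q * E" if "Q \<in> carrier_mat m m" "transpose_mat Q = Q" for Q
    using that c(1) T by (simp add: transpose_mult[of _ N m _ N] transpose_mult[of _ N m _ m]
       transpose_mult[of _ m m _ N]
       assoc_mult_mat[of _ N m _ m _ N])
  have c': "P * W * K \<in> carrier_mat m m" "K * W * P \<in> carrier_mat m m" using c Wc by auto
  show ?thesis
  proof (rule penrose_symmetric[of _ N])
    show "(?T * P * E) * (?T * K * E) = (?T * K * E) * (?T * P * E)"
      using c comm by (simp only: sw)
    have "(?T * P * E) * (?T * K * E) * (?T * P * E) = ?T * (P * W * K * W * P) * E"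
      using c c' by (simp only: sw)
    then show "(?T * P * E) * (?T * K * E) * (?T * P * E) = ?T * P * E"
      using assms(8) by (simp only:)
    have "(?T * K * E) * (?T * P * E) * (?T * K * E) = ?T * (K * W * P * W * K) * E"
      using c c' by (simp only: sw)
    then show "(?T * K * E) * (?T * P * E) * (?T * K * E) = ?T * K * E"
      using assms(9) by (simp only:)
  qed (use c T s sym in auto)
qed

section \<open>Circulant Fourier modes\<close>

text \<open>Multiplied by twice the sine of half the step, the sum telescopes. Over \<open>m\<close>
  terms the arguments at the two ends differ by a multiple of \<open>2 * pi\<close>, and the sine is
  nonzero because \<open>m\<close> does not divide \<open>k\<close>.\<close>

lemma sum_cos_progression_eq_0:
  fixes k :: int and c :: real
  assumes "m > 0" "\<not> int m dvd k"
  shows "(\<Sum>l<m. cos (2 * pi * of_int k * real l / real m + c)) = 0"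
proof -
  define h where "h = pi * of_int k / real m"
  have telescope: "2 * sin h * (\<Sum>l<p. cos (2 * h * real l + c)) = sin (2 * h * real p - h + c) - sin (c - h)" for p
  proof (induction p)
    case (Suc p)
    have "sin (2 * h * real (Suc p) - h + c) = sin ((2 * h * real p + c) + h)"
         "sin (2 * h * real p - h + c) = sin ((2 * h * real p + c) - h)"
      by (simp_all add: algebra_simps)
    then have "2 * sin h * cos (2 * h * real p + c) = sin (2 * h * real (Suc p) - h + c) - sin (2 * h * real p - h + c)"
      unfolding sin_add sin_diff by simp
    with Suc show ?case by (simp add: algebra_simps)
  qed simp
  have "2 * h * real m - h + c = (c - h) + 2 * pi * of_int k"
    using assms by (simp add: h_def)
  moreover have "sin (x + 2 * pi * of_int k) = sin x" for x
    by (simp add: sin_add sin_int_2pin cos_int_2pin)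
  ultimately have "2 * sin h * (\<Sum>l<m. cos (2 * h * real l + c)) = 0"
    using telescope[of m] by (simp only: diff_self)
  moreover have "sin h \<noteq> 0"
  proof
    assume "sin h = 0"
    then obtain i where "h = of_int i * pi" using sin_zero_iff_int2 by blast
    then have "of_int k = (of_int (i * int m) :: real)"
      using assms by (simp add: h_def field_simps)
    then have "k = i * int m" by (simp only: of_int_eq_iff)
    with assms show False by simp
  qed
  ultimately show ?thesis by (simp add: h_def algebra_simps)
qed

text \<open>A circulant matrix once \<open>g\<close> has period \<open>m\<close>. Taking
  \<open>g\<close> on integer differences instead of residues keeps shifts such as
  \<open>d - 1\<close> free of modular reduction.\<close>

definition cyc :: "nat \<Rightarrow> (int \<Rightarrow> real) \<Rightarrow> real mat" where
  "cyc m g = mat m m (\<lambda>(i, j). g (int i - int j))"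

text \<open>
  The eigenvalue of the circulant matrix \<open>E E'\<close> on the \<open>k\<close>-th Fourier mode is
  \<open>3 + 2 cos (2 pi k / m) = 1 + 4 phi_k^2\<close>, so \<open>cyc m (cos_mode m s)\<close> is \<open>(E E')^(-s)\<close> restricted to
  the complement of the constant vectors.
\<close>

definition cos_mode :: "nat \<Rightarrow> nat \<Rightarrow> int \<Rightarrow> real" where
  "cos_mode m s d =
     (\<Sum>k = 1..<m. cos (2 * pi * real k * of_int d / real m) / (3 + 2 * cos (2 * pi * real k / real m)) ^ s)
       / real m"

text \<open>Rows number the cycle vertices from 0. For \<open>j\<close> from 1 to \<open>m\<close>,
  cycle vertex \<open>j\<close> and inserted vertex \<open>m + j\<close> both meet row
  \<open>j - 1\<close>; the inserted one also meets the row \<open>j mod m\<close> of the cyclic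
  successor, which wraps at \<open>j = m\<close>.\<close>

definition gear_inc :: "nat \<Rightarrow> real mat" where
  "gear_inc m = mat m (2 * m + 1)
     (\<lambda>(a, j). of_bool (0 < j \<and> a = (j - 1) mod m) + of_bool (m < j \<and> a = j mod m))"

text \<open>The block number is at the same time the entry of \<open>g = E' 1\<close> at the
  vertex.\<close>

definition blk :: "nat \<Rightarrow> nat \<Rightarrow> nat" where
  "blk m i = (if i = 0 then 0 else if i \<le> m then 1 else 2)"

definition block_const :: "nat \<Rightarrow> (nat \<Rightarrow> nat \<Rightarrow> real) \<Rightarrow> real mat" where
  "block_const m f = mat (2 * m + 1) (2 * m + 1) (\<lambda>(i, j). f (blk m i) (blk m j))"

lemma gear_carriers [simp]:
  "cyc m g \<in> carrier_mat m m"
  "gear_inc m \<in> carrier_mat m (2 * m + 1)"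
  "block_const m f \<in> carrier_mat (2 * m + 1) (2 * m + 1)"
  by (auto simp: cyc_def gear_inc_def block_const_def)

lemmas gear_carriers_Suc [simp] = gear_carriers[simplified]

lemma gear_dims:
  "dim_row (cyc m g) = m" "dim_col (cyc m g) = m"
  "dim_row (gear_inc m) = m" "dim_col (gear_inc m) = Suc (2 * m)"
  "dim_row (block_const m f) = Suc (2 * m)" "dim_col (block_const m f) = Suc (2 * m)"
  by (simp_all add: cyc_def gear_inc_def block_const_def)

section \<open>Periodicity, recursion and sums of the Fourier modes\<close>

lemma cos_circle_periodic:
  assumes "m > 0" "int m dvd d - e"
  shows "cos (2 * pi * real k * of_int d / real m) = cos (2 * pi * real k * of_int e / real m)"
proof -
  obtain q where q: "d = e + int m * q" using assms(2) by (metis dvdE add.commute diff_add_cancel)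
  have "2 * pi * real k * of_int d / real m = 2 * pi * real k * of_int e / real m + 2 * pi * of_int (int k * q)"
    using assms(1) by (simp add: q field_simps)
  then show ?thesis by (simp only: cos_add sin_int_2pin cos_int_2pin mult_1_right mult_zero_right diff_zero)
qed

lemma cos_mode_periodic: "m > 0 \<Longrightarrow> int m dvd d - e \<Longrightarrow> cos_mode m s d = cos_mode m s e"
  unfolding cos_mode_def by (simp only: cos_circle_periodic[of m d e])

lemma cos_mode_minus: "cos_mode m s (- d) = cos_mode m s d"
  by (simp add: cos_mode_def)

text \<open>Since \<open>cos (x - w) + cos (x + w) = 2 * cos w * cos x\<close>, the stencil
  \<open>(1, 3, 1)\<close> multiplies each mode by its eigenvalue and so lowers the exponent by one.
  The eigenvalues are at least 1, hence nonzero.\<close>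

lemma cos_mode_Suc:
  "3 * cos_mode m (Suc s) d + cos_mode m (Suc s) (d - 1) + cos_mode m (Suc s) (d + 1) = cos_mode m s d"
proof -
  define w where "w k = 2 * pi * real k / real m" for k
  define l where "l k = 3 + 2 * cos (w k)" for k
  have l: "l k \<noteq> 0" for k using cos_ge_minus_one[of "w k"] unfolding l_def by linarith
  have mode: "cos_mode m s d = (\<Sum>k = 1..<m. cos (w k * of_int d) / l k ^ s) / real m" for s d
    by (simp add: cos_mode_def w_def l_def mult.assoc)
  have "3 * cos (w k * of_int d) + cos (w k * of_int (d - 1)) + cos (w k * of_int (d + 1))
      = l k * cos (w k * of_int d)" for k
  proof -
    have "w k * of_int (d - 1) = w k * of_int d - w k" "w k * of_int (d + 1) = w k * of_int d + w k"
      by (simp_all add: algebra_simps)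
    then show ?thesis by (simp only: cos_add cos_diff l_def) (simp add: algebra_simps)
  qed
  then have "3 * (cos (w k * of_int d) / l k ^ Suc s) + cos (w k * of_int (d - 1)) / l k ^ Suc s
      + cos (w k * of_int (d + 1)) / l k ^ Suc s = cos (w k * of_int d) / l k ^ s" for k
    using l[of k] by (simp add: add_divide_distrib[symmetric])
  then have "(\<Sum>k = 1..<m. 3 * (cos (w k * of_int d) / l k ^ Suc s) + cos (w k * of_int (d - 1)) / l k ^ Suc s
      + cos (w k * of_int (d + 1)) / l k ^ Suc s) = (\<Sum>k = 1..<m. cos (w k * of_int d) / l k ^ s)"
    by (rule sum.cong[OF refl])
  then have "3 * (\<Sum>k = 1..<m. cos (w k * of_int d) / l k ^ Suc s) + (\<Sum>k = 1..<m. cos (w k * of_int (d - 1)) / l k ^ Suc s)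
     + (\<Sum>k = 1..<m. cos (w k * of_int (d + 1)) / l k ^ Suc s) = (\<Sum>k = 1..<m. cos (w k * of_int d) / l k ^ s)"
    by (simp only: sum.distrib sum_distrib_left)
  from arg_cong[OF this, of "\<lambda>x. x / real m"]
  show ?thesis unfolding mode by (simp only: add_divide_distrib times_divide_eq_right)
qed

text \<open>The sum over all \<open>k < m\<close> is \<open>m\<close> times the indicator of
  \<open>m dvd d\<close>; leaving out \<open>k = 0\<close> subtracts 1. Hence exponent 0 gives the
  projection \<open>P = I - J / m\<close>.\<close>

lemma cos_mode_0:
  assumes "m > 0"
  shows "cos_mode m 0 d = of_bool (int m dvd d) - 1 / real m"
proof -
  have "{..<m} = insert 0 {1..<m}" using assms by auto
  then have "(\<Sum>k<m. cos (2 * pi * real k * of_int d / real m))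
      = 1 + (\<Sum>k = 1..<m. cos (2 * pi * real k * of_int d / real m))" by simp
  moreover have "(\<Sum>k<m. cos (2 * pi * real k * of_int d / real m)) = of_bool (int m dvd d) * real m"
  proof (cases "int m dvd d")
    case True
    then obtain q where "d = int m * q" by blast
    then have "cos (2 * pi * real k * of_int d / real m) = 1" for k
      using assms cos_int_2pin[of "int k * q"] by (simp add: mult_ac)
    then show ?thesis using True by simp
  next
    case False
    then show ?thesis using sum_cos_progression_eq_0[OF assms False, of 0] by (simp add: mult_ac)
  qed
  ultimately show ?thesis using assms by (simp add: cos_mode_def field_simps)
qed

text \<open>Only the frequency \<open>k = 0\<close>, which is left out, has a nonzero sum over a
  period. The modes therefore annihilate constant vectors.\<close>

lemma sum_cos_mode:
  assumes "m > 0"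
  shows "(\<Sum>l<m. cos_mode m s (d + int l)) = 0"
proof -
  have "(\<Sum>l<m. cos (2 * pi * real k * of_int (d + int l) / real m)) = 0" if "k \<in> {1..<m}" for k
  proof -
    have "\<not> int m dvd int k" using that by (auto simp: dvd_imp_le)
    from sum_cos_progression_eq_0[OF assms this, of "2 * pi * real k * of_int d / real m"]
    show ?thesis by (simp add: algebra_simps add_divide_distrib)
  qed
  then show ?thesis
    unfolding cos_mode_def sum_divide_distrib[symmetric]
    by (subst sum.swap) (simp add: sum_divide_distrib[symmetric])
qed

section \<open>Products with the incidence matrix \<open>gear_inc\<close>\<close>

lemma sum_gear_vertices:
  fixes h :: "nat \<Rightarrow> real"
  shows "(\<Sum>j<2 * m + 1. h j) = h 0 + (\<Sum>t<m. h (1 + t)) + (\<Sum>t<m. h (m + 1 + t))"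
proof -
  have "(\<Sum>i<m + q. f i) = (\<Sum>i<m. f i) + (\<Sum>i<q. f (m + i))" for q and f :: "nat \<Rightarrow> real"
    by (induction q) (simp_all add: add.assoc)
  from this[of "\<lambda>i. h (Suc i)" m] show ?thesis
    by (simp add: sum.lessThan_Suc_shift mult_2 add.assoc del: sum.lessThan_Suc)
qed

lemma mult_mat_entry:
  fixes A B :: "real mat"
  assumes "A \<in> carrier_mat r q" "B \<in> carrier_mat q c" "i < r" "j < c"
  shows "(A * B) $$ (i, j) = (\<Sum>a<q. A $$ (i, a) * B $$ (a, j))"
  using assms by (auto simp: scalar_prod_def atLeast0LessThan intro!: sum.cong)

lemma mult_gear_inc_entry:
  assumes "m > 0" "B \<in> carrier_mat r m" "i < r" "j < 2 * m + 1"
  shows "(B * gear_inc m) $$ (i, j) =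
    of_bool (0 < j) * B $$ (i, (j - 1) mod m) + of_bool (m < j) * B $$ (i, j mod m)"
proof -
  have "(B * gear_inc m) $$ (i, j) = (\<Sum>a<m. B $$ (i, a) * gear_inc m $$ (a, j))"
    by (rule mult_mat_entry) (use assms in auto)
  also have "\<dots> = (\<Sum>a<m. of_bool (0 < j) * (if a = (j - 1) mod m then B $$ (i, a) else 0)
           + of_bool (m < j) * (if a = j mod m then B $$ (i, a) else 0))"
    by (rule sum.cong) (use assms(4) in \<open>auto simp: gear_inc_def\<close>)
  finally show ?thesis using assms by (simp add: sum.distrib sum_distrib_left[symmetric])
qed

lemma transpose_gear_inc_mult_entry:
  assumes "m > 0" "B \<in> carrier_mat m r" "i < 2 * m + 1" "j < r"
  shows "(transpose_mat (gear_inc m) * B) $$ (i, j) =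
    of_bool (0 < i) * B $$ ((i - 1) mod m, j) + of_bool (m < i) * B $$ (i mod m, j)"
proof -
  have "transpose_mat (gear_inc m) * B = transpose_mat (transpose_mat B * gear_inc m)"
    using assms(2) gear_carriers(2)[of m]
    by (simp add: transpose_mult[of _ r m _ "2 * m + 1"] del: gear_carriers)
  moreover have "dim_col (gear_inc m) = 2 * m + 1" by (simp add: gear_inc_def)
  ultimately show ?thesis
    using assms mult_gear_inc_entry[of m "transpose_mat B" r j i] by simp
qed

lemma gear_inc_mult_entry:
  assumes "B \<in> carrier_mat (2 * m + 1) r" "a < m" "j < r"
  shows "(gear_inc m * B) $$ (a, j) =
    B $$ (1 + a, j) + B $$ (m + 1 + a, j) + B $$ (if a = 0 then 2 * m else m + a, j)"
proof -
  \<comment> \<open>The zero-based number of the inserted vertex whose successor is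
    \<open>a\<close>; for \<open>a = 0\<close> it is the last one, column
    \<open>2 * m\<close>.\<close>
  let ?p = "if a = 0 then m - 1 else a - 1"
  have sel: "(a = Suc t mod m) = (t = ?p)" if "t < m" for t
    using that assms(2) by (cases "Suc t = m") auto
  have "(gear_inc m * B) $$ (a, j) = (\<Sum>i<2 * m + 1. gear_inc m $$ (a, i) * B $$ (i, j))"
    by (rule mult_mat_entry) (use assms in auto)
  also have "\<dots> = (\<Sum>t<m. gear_inc m $$ (a, 1 + t) * B $$ (1 + t, j))
     + (\<Sum>t<m. gear_inc m $$ (a, m + 1 + t) * B $$ (m + 1 + t, j))"
    unfolding sum_gear_vertices using assms by (simp add: gear_inc_def)
  also have "(\<Sum>t<m. gear_inc m $$ (a, 1 + t) * B $$ (1 + t, j))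
      = (\<Sum>t<m. (if t = a then B $$ (1 + t, j) else 0))"
    by (rule sum.cong) (use assms(2) in \<open>auto simp: gear_inc_def\<close>)
  also have "(\<Sum>t<m. gear_inc m $$ (a, m + 1 + t) * B $$ (m + 1 + t, j))
      = (\<Sum>t<m. (if t = a then B $$ (m + 1 + t, j) else 0) + (if t = ?p then B $$ (m + 1 + t, j) else 0))"
  proof (rule sum.cong)
    fix t assume "t \<in> {..<m}"
    then have t: "t < m" by simp
    have "(m + 1 + t) mod m = Suc t mod m" using mod_add_self1[of m "Suc t"] by simp
    then have "gear_inc m $$ (a, m + 1 + t) = of_bool (a = t) + of_bool (t = ?p)"
      using assms(2) t sel[OF t] by (simp add: gear_inc_def split del: if_split)
    then show "gear_inc m $$ (a, m + 1 + t) * B $$ (m + 1 + t, j) =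
        (if t = a then B $$ (m + 1 + t, j) else 0) + (if t = ?p then B $$ (m + 1 + t, j) else 0)"
      by (simp add: distrib_right of_bool_def)
  qed simp
  also have "(\<Sum>t<m. (if t = a then B $$ (1 + t, j) else 0)) +
      (\<Sum>t<m. (if t = a then B $$ (m + 1 + t, j) else 0) + (if t = ?p then B $$ (m + 1 + t, j) else 0))
      = B $$ (1 + a, j) + B $$ (m + 1 + a, j) + B $$ (m + 1 + ?p, j)"
    using assms by (auto simp: sum.distrib)
  also have "m + 1 + ?p = (if a = 0 then 2 * m else m + a)" using assms by auto
  finally show ?thesis .
qed

section \<open>The Gram matrix \<open>E E'\<close> acting on circulant matrices\<close>

lemma int_mod_dvd: "int m dvd int (j mod m) - int j"
  by (simp add: of_nat_mod mod_eq_dvd_iff[symmetric])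

lemma cyc_entry: "i < m \<Longrightarrow> j < m \<Longrightarrow> cyc m g $$ (i, j) = g (int i - int j)"
  by (simp add: cyc_def)

lemma transpose_cyc_cos_mode: "transpose_mat (cyc m (cos_mode m s)) = cyc m (cos_mode m s)"
proof (rule eq_matI)
  fix i j assume "i < dim_row (cyc m (cos_mode m s))" "j < dim_col (cyc m (cos_mode m s))"
  then show "transpose_mat (cyc m (cos_mode m s)) $$ (i, j) = cyc m (cos_mode m s) $$ (i, j)"
    using cos_mode_minus[of m s "int i - int j"] by (simp add: cyc_def)
qed (simp_all add: cyc_def)

text \<open>A cycle vertex meets its own column and those of its two inserted neighbours, and shares
  one inserted vertex with each cyclic neighbour. So \<open>E E'\<close> acts as the cyclic stencil
  with 3 on the diagonal and 1 on either side.\<close>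

lemma gear_inc_gram_mult_cyc:
  assumes m: "m > 0" and per: "\<And>d e. int m dvd d - e \<Longrightarrow> g d = g e"
  shows "gear_inc m * transpose_mat (gear_inc m) * cyc m g = cyc m (\<lambda>d. 3 * g d + g (d - 1) + g (d + 1))"
proof (rule eq_matI)
  fix i j
  assume "i < dim_row (cyc m (\<lambda>d. 3 * g d + g (d - 1) + g (d + 1)))"
    "j < dim_col (cyc m (\<lambda>d. 3 * g d + g (d - 1) + g (d + 1)))"
  then have ij: "i < m" "j < m" by (simp_all add: cyc_def)
  let ?TC = "transpose_mat (gear_inc m) * cyc m g"
  \<comment> \<open>Vertex \<open>l\<close> meets row \<open>l - 1\<close>, and row \<open>l\<close>
    too when \<open>l > m\<close>; periodicity of \<open>g\<close> removes the reduction modulo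
    \<open>m\<close>.\<close>
  have TC: "?TC $$ (l, j) = of_bool (0 < l) * g (int l - 1 - int j) + of_bool (m < l) * g (int l - int j)"
    if "l < 2 * m + 1" for l
  proof -
    have p: "0 < l \<Longrightarrow> g (int ((l - 1) mod m) - int j) = g (int l - 1 - int j)"
      using int_mod_dvd[of m "l - 1"] by (intro per) (simp add: of_nat_diff algebra_simps)
    have q: "g (int (l mod m) - int j) = g (int l - int j)"
      using int_mod_dvd[of m l] by (intro per) simp
    have "?TC $$ (l, j) = of_bool (0 < l) * g (int ((l - 1) mod m) - int j) + of_bool (m < l) * g (int (l mod m) - int j)"
      using transpose_gear_inc_mult_entry[OF m gear_carriers(1) that ij(2), of g] m ij by (simp add: cyc_entry)
    then show ?thesis using p q by (cases "0 < l") simp_all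
  qed
  have TCc: "?TC \<in> carrier_mat (2 * m + 1) m" by (intro mult_carrier_mat[of _ _ m]) auto
  have "(gear_inc m * transpose_mat (gear_inc m) * cyc m g) $$ (i, j) = (gear_inc m * ?TC) $$ (i, j)"
    by (subst assoc_mult_mat[of _ m "2 * m + 1" _ m _ m]) auto
  also have "\<dots> = g (int (1 + i) - 1 - int j)
      + (g (int (m + 1 + i) - 1 - int j) + g (int (m + 1 + i) - int j))
      + (g (int (if i = 0 then 2 * m else m + i) - 1 - int j) + g (int (if i = 0 then 2 * m else m + i) - int j))"
    unfolding gear_inc_mult_entry[OF TCc ij] using ij m by (simp add: TC)
  also have "g (int (m + 1 + i) - 1 - int j) = g (int i - int j)" by (rule per) simp
  also have "g (int (m + 1 + i) - int j) = g (int i - int j + 1)" by (rule per) simp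
  also have "g (int (if i = 0 then 2 * m else m + i) - 1 - int j) = g (int i - int j - 1)" by (rule per) simp
  also have "g (int (if i = 0 then 2 * m else m + i) - int j) = g (int i - int j)" by (rule per) simp
  finally show "(gear_inc m * transpose_mat (gear_inc m) * cyc m g) $$ (i, j) =
      cyc m (\<lambda>d. 3 * g d + g (d - 1) + g (d + 1)) $$ (i, j)"
    using ij by (simp add: cyc_entry)
qed (auto simp: gear_inc_def cyc_def)

lemma gear_inc_gram_mult_cos_mode:
  assumes "m > 0"
  shows "gear_inc m * transpose_mat (gear_inc m) * cyc m (cos_mode m (Suc s)) = cyc m (cos_mode m s)"
proof -
  have "gear_inc m * transpose_mat (gear_inc m) * cyc m (cos_mode m (Suc s)) = cyc m (\<lambda>d.
      3 * cos_mode m (Suc s) d + cos_mode m (Suc s) (d - 1) + cos_mode m (Suc s) (d + 1))"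
    by (rule gear_inc_gram_mult_cyc[OF assms]) (rule cos_mode_periodic[OF assms])
  then show ?thesis unfolding cos_mode_Suc .
qed

lemma cos_mode_mult_gear_inc_gram:
  assumes "m > 0"
  shows "cyc m (cos_mode m (Suc s)) * (gear_inc m * transpose_mat (gear_inc m)) = cyc m (cos_mode m s)"
proof -
  let ?W = "gear_inc m * transpose_mat (gear_inc m)"
  have W: "?W \<in> carrier_mat m m" by (rule mult_carrier_mat[of _ _ "2 * m + 1"]) auto
  have "transpose_mat ?W = ?W" by (simp add: transpose_mult[of _ m "2 * m + 1" _ m])
  then have "cyc m (cos_mode m (Suc s)) * ?W = transpose_mat (?W * cyc m (cos_mode m (Suc s)))"
    using transpose_mult[OF W gear_carriers(1), of "cos_mode m (Suc s)"] by (simp add: transpose_cyc_cos_mode)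
  then show ?thesis by (simp only: gear_inc_gram_mult_cos_mode[OF assms] transpose_cyc_cos_mode)
qed

text \<open>The left factor is \<open>I - J / m\<close>, and its \<open>J\<close> part only produces
  column sums of the right factor, which are zero.\<close>

lemma cos_mode_0_mult:
  assumes m: "m > 0"
  shows "cyc m (cos_mode m 0) * cyc m (cos_mode m s) = cyc m (cos_mode m s)"
proof (rule eq_matI)
  fix i j assume "i < dim_row (cyc m (cos_mode m s))" "j < dim_col (cyc m (cos_mode m s))"
  then have ij: "i < m" "j < m" by (simp_all add: cyc_def)
  have delta: "int m dvd int i - int l \<longleftrightarrow> l = i" if "l < m" for l
    using zdvd_not_zless[of "\<bar>int i - int l\<bar>" "int m"] that ij by (cases "l = i") auto
  have "(cyc m (cos_mode m 0) * cyc m (cos_mode m s)) $$ (i, j) =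
      (\<Sum>l<m. cyc m (cos_mode m 0) $$ (i, l) * cyc m (cos_mode m s) $$ (l, j))"
    by (rule mult_mat_entry) (use ij in auto)
  also have "\<dots> = (\<Sum>l<m. (if l = i then cos_mode m s (int l - int j) else 0)
      - 1 / real m * cos_mode m s (- int j + int l))"
    by (rule sum.cong) (use ij delta in \<open>auto simp: cyc_entry cos_mode_0[OF m] left_diff_distrib\<close>)
  also have "\<dots> = cos_mode m s (int i - int j)"
    using ij sum_cos_mode[OF m, of s "- int j"] by (simp add: sum_subtractf sum_divide_distrib[symmetric])
  finally show "(cyc m (cos_mode m 0) * cyc m (cos_mode m s)) $$ (i, j) = cyc m (cos_mode m s) $$ (i, j)"
    using ij by (simp add: cyc_entry)
qed (auto simp: cyc_def)

lemma cos_mode_mult_0: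
  assumes m: "m > 0"
  shows "cyc m (cos_mode m s) * cyc m (cos_mode m 0) = cyc m (cos_mode m s)"
  using arg_cong[OF cos_mode_0_mult[OF m, of s], of transpose_mat]
  by (simp add: transpose_mult[of _ m m _ m] transpose_cyc_cos_mode)

text \<open>Write \<open>P\<close>, \<open>V\<close>, \<open>K\<close> for exponents 0, 1, 2 and
  \<open>W = E E'\<close>. Multiplication by \<open>W\<close> on either side takes \<open>K\<close>
  to \<open>V\<close> and \<open>V\<close> to \<open>P\<close>, while \<open>P\<close> is an
  identity for all modes. Thus \<open>P W K = K W P = V\<close>.\<close>

lemma penrose_gear_modes:
  assumes m: "m > 0"
  shows "penrose_conditions
     (transpose_mat (gear_inc m) * cyc m (cos_mode m 0) * gear_inc m)
     (transpose_mat (gear_inc m) * cyc m (cos_mode m 2) * gear_inc m)"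
proof (rule penrose_sandwich[of _ m "2 * m + 1"])
  let ?P = "cyc m (cos_mode m 0)" and ?V = "cyc m (cos_mode m 1)" and ?K = "cyc m (cos_mode m 2)"
  define W where "W = gear_inc m * transpose_mat (gear_inc m)"
  have W: "W \<in> carrier_mat m m" unfolding W_def by (rule mult_carrier_mat[of _ _ "2 * m + 1"]) auto
  note assoc = assoc_mult_mat[of _ m m _ m _ m]
  have r: "W * ?K = ?V" "W * ?V = ?P" "?K * W = ?V" "?V * W = ?P"
    using gear_inc_gram_mult_cos_mode[OF m, folded W_def] cos_mode_mult_gear_inc_gram[OF m, folded W_def]
    by (simp_all add: numeral_2_eq_2)
  note r0 = cos_mode_0_mult[OF m] cos_mode_mult_0[OF m]
  have PWK: "?P * W * ?K = ?V" using W r r0 by (simp add: assoc)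
  have KWP: "?K * W * ?P = ?V" using W r r0 by simp
  show "gear_inc m * transpose_mat (gear_inc m) = gear_inc m * transpose_mat (gear_inc m)" ..
  show "?P * (gear_inc m * transpose_mat (gear_inc m)) * ?K = ?K * (gear_inc m * transpose_mat (gear_inc m)) * ?P"
    using PWK KWP by (simp add: W_def)
  show "?P * (gear_inc m * transpose_mat (gear_inc m)) * ?K * (gear_inc m * transpose_mat (gear_inc m)) * ?P = ?P"
    using PWK r r0 unfolding W_def by simp
  \<comment> \<open>This is \<open>V * V\<close>, a product of two modes neither of which is
    \<open>P\<close>; writing the left factor as \<open>K * W\<close> regroups it into
    \<open>K * P\<close>.\<close>
  have "?V * (W * ?K) = (?K * W) * ?V" using r by simp
  also have "\<dots> = ?K * (W * ?V)" using W by (simp add: assoc)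
  also have "\<dots> = ?K" using r r0 by simp
  finally have "?V * (W * ?K) = ?K" .
  then have "?K * W * ?P * W * ?K = ?K" unfolding KWP using W by (simp add: assoc)
  then show "?K * (gear_inc m * transpose_mat (gear_inc m)) * ?P * (gear_inc m * transpose_mat (gear_inc m)) * ?K = ?K"
    by (simp only: W_def)
qed (simp_all add: transpose_cyc_cos_mode)

text \<open>Each row of \<open>E\<close> meets one cycle vertex and two inserted ones, so
  \<open>E\<close> times a block-constant matrix has constant columns, which the modes
  annihilate.\<close>

lemma gear_modes_mult_block_const:
  assumes m: "m > 0"
  shows "transpose_mat (gear_inc m) * cyc m (cos_mode m s) * gear_inc m * block_const m f = 0\<^sub>m (2 * m + 1) (2 * m + 1)"
proof -
  let ?C = "cyc m (cos_mode m s)" and ?EB = "gear_inc m * block_const m f"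
  have EBc: "?EB \<in> carrier_mat m (2 * m + 1)" by (rule mult_carrier_mat[of _ _ "2 * m + 1"]) auto
  have EB: "?EB $$ (a, j) = f 1 (blk m j) + 2 * f 2 (blk m j)" if "a < m" "j < 2 * m + 1" for a j
    unfolding gear_inc_mult_entry[OF gear_carriers(3) that] using that by (simp add: block_const_def blk_def)
  have "?C * ?EB = 0\<^sub>m m (2 * m + 1)"
  proof (rule eq_matI)
    fix i j assume "i < dim_row (0\<^sub>m m (2 * m + 1) :: real mat)" "j < dim_col (0\<^sub>m m (2 * m + 1) :: real mat)"
    then have ij: "i < m" "j < 2 * m + 1" by simp_all
    have "(?C * ?EB) $$ (i, j) = (\<Sum>a<m. ?C $$ (i, a) * ?EB $$ (a, j))"
      by (rule mult_mat_entry) (use ij EBc in auto)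
    also have "\<dots> = (\<Sum>a<m. cos_mode m s (- int i + int a) * (f 1 (blk m j) + 2 * f 2 (blk m j)))"
    proof (rule sum.cong)
      fix a assume "a \<in> {..<m}"
      then show "?C $$ (i, a) * ?EB $$ (a, j) = cos_mode m s (- int i + int a) * (f 1 (blk m j) + 2 * f 2 (blk m j))"
        using ij cos_mode_minus[of m s "int i - int a"] by (simp add: cyc_entry EB)
    qed simp
    also have "\<dots> = 0" using sum_cos_mode[OF m, of s "- int i"] by (simp add: sum_distrib_right[symmetric])
    finally show "(?C * ?EB) $$ (i, j) = 0\<^sub>m m (2 * m + 1) $$ (i, j)" using ij by simp
  qed (auto simp: cyc_def block_const_def)
  moreover have "transpose_mat (gear_inc m) * ?C * gear_inc m * block_const m f = transpose_mat (gear_inc m) * (?C * ?EB)"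
  proof -
    let ?T = "transpose_mat (gear_inc m)" and ?E = "gear_inc m" and ?B = "block_const m f"
    have T: "?T \<in> carrier_mat (2 * m + 1) m" and CE: "?C * ?E \<in> carrier_mat m (2 * m + 1)"
      by (auto intro: mult_carrier_mat[of _ _ m])
    have "?T * ?C * ?E * ?B = ?T * (?C * ?E) * ?B"
      by (simp only: assoc_mult_mat[OF T gear_carriers(1) gear_carriers(2)])
    also have "\<dots> = ?T * (?C * ?E * ?B)" by (rule assoc_mult_mat[OF T CE gear_carriers(3)])
    also have "?C * ?E * ?B = ?C * ?EB" by (rule assoc_mult_mat[OF gear_carriers])
    finally show ?thesis .
  qed
  ultimately show ?thesis by (simp add: right_mult_zero_mat[of _ "2 * m + 1" m])
qed

text \<open>Vertex \<open>i\<close> selects row \<open>i - 1\<close>, and row \<open>i\<close> too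
  if it is inserted; the four terms come from the differences of selected rows. By periodicity the
  vertex numbers enter without subtracting \<open>m\<close>.\<close>

lemma gear_modes_entry:
  assumes m: "m > 0" and per: "\<And>d e. int m dvd d - e \<Longrightarrow> g d = g e"
    and ij: "i < 2 * m + 1" "j < 2 * m + 1"
  shows "(transpose_mat (gear_inc m) * cyc m g * gear_inc m) $$ (i, j) =
    of_bool (0 < i \<and> 0 < j) * (g (int i - int j) + of_bool (m < j) * g (int i - int j - 1)
      + of_bool (m < i) * g (int i - int j + 1) + of_bool (m < i \<and> m < j) * g (int i - int j))"
proof -
  let ?TC = "transpose_mat (gear_inc m) * cyc m g"
  have TCc: "?TC \<in> carrier_mat (2 * m + 1) m" by (intro mult_carrier_mat[of _ _ m]) auto
  have mods: "g (int (a mod m) - int (b mod m)) = g (int a - int b)" for a b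
  proof (rule per)
    have "int (a mod m) - int (b mod m) - (int a - int b) = (int (a mod m) - int a) - (int (b mod m) - int b)"
      by simp
    then show "int m dvd int (a mod m) - int (b mod m) - (int a - int b)"
      using dvd_diff[OF int_mod_dvd[of m a] int_mod_dvd[of m b]] by (simp only:)
  qed
  have pq: "g (int ((i - 1) mod m) - int ((j - 1) mod m)) = g (int i - int j)"
      "g (int ((i - 1) mod m) - int (j mod m)) = g (int i - int j - 1)"
      "g (int (i mod m) - int ((j - 1) mod m)) = g (int i - int j + 1)"
      "g (int (i mod m) - int (j mod m)) = g (int i - int j)"
    if "0 < i" "0 < j"
    unfolding mods using that by (simp_all add: of_nat_diff algebra_simps)
  have "?TC $$ (i, l) = of_bool (0 < i) * g (int ((i - 1) mod m) - int l) + of_bool (m < i) * g (int (i mod m) - int l)"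
    if "l < m" for l
    unfolding transpose_gear_inc_mult_entry[OF m gear_carriers(1) ij(1) that] using m that by (simp add: cyc_entry)
  note TC = this[OF mod_less_divisor[OF m, of "j - 1"]] this[OF mod_less_divisor[OF m, of j]]
  show ?thesis
    unfolding mult_gear_inc_entry[OF m TCc ij] TC
    using pq by (cases "0 < i"; cases "0 < j") (simp_all only:, simp_all)
qed

section \<open>Block-constant matrices as 3 by 3 matrices with block sizes as weights\<close>

lemma block_const_mult:
  "block_const m f * block_const m g =
     block_const m (\<lambda>p r. f p 0 * g 0 r + real m * f p 1 * g 1 r + real m * f p 2 * g 2 r)"
proof (rule eq_matI)
  let ?h = "\<lambda>p r. f p 0 * g 0 r + real m * f p 1 * g 1 r + real m * f p 2 * g 2 r"
  fix i j assume "i < dim_row (block_const m ?h)" "j < dim_col (block_const m ?h)"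
  then have ij: "i < 2 * m + 1" "j < 2 * m + 1" by (simp_all add: block_const_def)
  have "(block_const m f * block_const m g) $$ (i, j) =
      (\<Sum>a<2 * m + 1. block_const m f $$ (i, a) * block_const m g $$ (a, j))"
    by (rule mult_mat_entry[OF gear_carriers(3) gear_carriers(3) ij])
  also have "\<dots> = block_const m ?h $$ (i, j)"
    unfolding sum_gear_vertices using ij by (simp add: block_const_def blk_def)
  finally show "(block_const m f * block_const m g) $$ (i, j) = block_const m ?h $$ (i, j)" .
qed (simp_all add: block_const_def)

lemma block_const_cong:
  assumes "\<And>p r. p \<in> {0, 1, 2} \<Longrightarrow> r \<in> {0, 1, 2} \<Longrightarrow> f p r = g p r"
  shows "block_const m f = block_const m g"
  by (rule eq_matI) (auto simp: block_const_def blk_def intro!: assms)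

lemma transpose_block_const: "transpose_mat (block_const m f) = block_const m (\<lambda>p r. f r p)"
  by (rule eq_matI) (auto simp: block_const_def)

section \<open>The block-constant part and the distance matrix\<close>

text \<open>As block numbers are values of \<open>g\<close>, this is \<open>m\<close> times the
  entry of \<open>Y = g 1' + 1 g' - (2 / m) g g'\<close>.\<close>

definition dist_num :: "nat \<Rightarrow> nat \<Rightarrow> nat \<Rightarrow> real" where
  "dist_num m p r = real m * (real p + real r) - 2 * real p * real r"

text \<open>
  Numerators of the vector \<open>u\<close> and of the vector spanning the range of \<open>A\<close>, with the common
  denominators \<open>m (m + 5)\<close> and \<open>3 m\<close> removed; blocks are numbered 0 (center), 1 (cycle), 2 (inserted).
\<close>

definition u_num :: "nat \<Rightarrow> nat \<Rightarrow> real" where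
  "u_num m p = (if p = 0 then 10 - 3 * real m else if p = 1 then 5 - real m else real m)"

definition v_num :: "nat \<Rightarrow> nat \<Rightarrow> real" where
  "v_num m p = (if p = 0 then 3 * real m else if p = 1 then real m - 1 else - (real m + 2))"

definition pinv_num :: "nat \<Rightarrow> nat \<Rightarrow> nat \<Rightarrow> real" where
  "pinv_num m p r = u_num m p * u_num m r - v_num m p * v_num m r"

text \<open>The product of the two block-constant parts: the projection onto the span of \<open>1\<close> and \<open>g\<close>.\<close>

definition proj_num :: "nat \<Rightarrow> nat \<Rightarrow> nat \<Rightarrow> real" where
  "proj_num m p r =
     (if p = 0 \<and> r = 0 then 5 * real m
      else if p = 0 \<and> r = 1 \<or> p = 1 \<and> r = 0 then 2 * real m
      else if p = 0 \<or> r = 0 then - real m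
      else if p = 1 \<and> r = 1 then real m + 1
      else if p = 2 \<and> r = 2 then real m + 4
      else 2)"

definition dist_blocks :: "nat \<Rightarrow> nat \<Rightarrow> nat \<Rightarrow> real" where
  "dist_blocks m p r = dist_num m p r / real m"

text \<open>The block entries of \<open>(m / 2) u u' - A / 2\<close>, which is to be the
  pseudoinverse of \<open>Y\<close>.\<close>

definition pinv_blocks :: "nat \<Rightarrow> nat \<Rightarrow> nat \<Rightarrow> real" where
  "pinv_blocks m p r = pinv_num m p r / (2 * real m * (real m + 5)\<^sup>2)"

definition proj_blocks :: "nat \<Rightarrow> nat \<Rightarrow> nat \<Rightarrow> real" where
  "proj_blocks m p r = proj_num m p r / (real m * (real m + 5))"

lemma transpose_dist_pinv_blocks:
  "transpose_mat (block_const m (dist_blocks m)) = block_const m (dist_blocks m)"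
  "transpose_mat (block_const m (pinv_blocks m)) = block_const m (pinv_blocks m)"
  unfolding transpose_block_const
  by (auto simp: dist_blocks_def pinv_blocks_def dist_num_def pinv_num_def algebra_simps
    intro!: block_const_cong)

text \<open>These are \<open>Y Z = Q\<close>, \<open>Q Y = Y\<close> and \<open>Q Z = Z\<close> with
  denominators cleared, \<open>Z\<close> being the candidate inverse and \<open>Q\<close> the
  projection with numerators \<open>proj_num\<close>. For each of the nine block pairs this leaves a
  polynomial identity in \<open>x\<close>.\<close>

lemma block_num_products:
  fixes m :: nat
  defines "x \<equiv> real m"
  assumes "p \<in> {0, 1, 2}" "r \<in> {0, 1, 2}"
  shows "dist_num m p 0 * pinv_num m 0 r + x * dist_num m p 1 * pinv_num m 1 r + x * dist_num m p 2 * pinv_num m 2 r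
       = 2 * x * (x + 5) * proj_num m p r"
    and "proj_num m p 0 * dist_num m 0 r + x * proj_num m p 1 * dist_num m 1 r + x * proj_num m p 2 * dist_num m 2 r
       = x * (x + 5) * dist_num m p r"
    and "proj_num m p 0 * pinv_num m 0 r + x * proj_num m p 1 * pinv_num m 1 r + x * proj_num m p 2 * pinv_num m 2 r
       = x * (x + 5) * pinv_num m p r"
  using assms(2,3) unfolding dist_num_def pinv_num_def proj_num_def u_num_def v_num_def x_def[symmetric]
  by (elim insertE emptyE; simp add: algebra_simps)+

lemma penrose_dist_blocks:
  assumes m: "m > 0"
  shows "penrose_conditions (block_const m (dist_blocks m)) (block_const m (pinv_blocks m))"
proof (rule penrose_symmetric[of _ "2 * m + 1"])
  let ?Y = "block_const m (dist_blocks m)" and ?Z = "block_const m (pinv_blocks m)"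
    and ?Q = "block_const m (proj_blocks m)"
  have nz: "real m \<noteq> 0" "real m + 5 \<noteq> 0" using m by auto
  have common: "a1 / c * (b1 / d) + x * (a2 / c) * (b2 / d) + x * (a3 / c) * (b3 / d)
      = (a1 * b1 + x * a2 * b2 + x * a3 * b3) / (c * d)" for a1 a2 a3 b1 b2 b3 c d x :: real
    by (simp add: add_divide_distrib)
  show sym: "transpose_mat ?Y = ?Y" "transpose_mat ?Z = ?Z"
    by (rule transpose_dist_pinv_blocks)+
  have YZ: "?Y * ?Z = ?Q"
    unfolding block_const_mult
  proof (rule block_const_cong)
    fix p r :: nat assume pr: "p \<in> {0, 1, 2}" "r \<in> {0, 1, 2}"
    show "dist_blocks m p 0 * pinv_blocks m 0 r + real m * dist_blocks m p 1 * pinv_blocks m 1 r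
        + real m * dist_blocks m p 2 * pinv_blocks m 2 r = proj_blocks m p r"
      unfolding dist_blocks_def pinv_blocks_def proj_blocks_def common block_num_products(1)[OF pr]
      using nz by (simp add: power2_eq_square)
  qed
  \<comment> \<open>Transposing gives the product in the other order, and \<open>Q\<close> is itself
    symmetric.\<close>
  have "?Z * ?Y = transpose_mat (?Y * ?Z)"
    using sym by (simp add: transpose_mult[of _ "2 * m + 1" "2 * m + 1" _ "2 * m + 1"])
  also have "\<dots> = ?Q"
    unfolding YZ transpose_block_const
    by (rule block_const_cong) (auto simp: proj_blocks_def proj_num_def)
  finally have ZY: "?Z * ?Y = ?Q" .
  show "?Y * ?Z = ?Z * ?Y" using YZ ZY by simp
  have "?Q * ?Y = ?Y"
    unfolding block_const_mult
  proof (rule block_const_cong)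
    fix p r :: nat assume pr: "p \<in> {0, 1, 2}" "r \<in> {0, 1, 2}"
    show "proj_blocks m p 0 * dist_blocks m 0 r + real m * proj_blocks m p 1 * dist_blocks m 1 r
        + real m * proj_blocks m p 2 * dist_blocks m 2 r = dist_blocks m p r"
      unfolding dist_blocks_def proj_blocks_def common block_num_products(2)[OF pr]
      using nz by simp
  qed
  then show "?Y * ?Z * ?Y = ?Y" by (simp only: YZ)
  have "?Q * ?Z = ?Z"
    unfolding block_const_mult
  proof (rule block_const_cong)
    fix p r :: nat assume pr: "p \<in> {0, 1, 2}" "r \<in> {0, 1, 2}"
    show "proj_blocks m p 0 * pinv_blocks m 0 r + real m * proj_blocks m p 1 * pinv_blocks m 1 r
        + real m * proj_blocks m p 2 * pinv_blocks m 2 r = pinv_blocks m p r"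
      unfolding pinv_blocks_def proj_blocks_def common block_num_products(3)[OF pr]
      using nz by simp
  qed
  then show "?Z * ?Y * ?Z = ?Z" by (simp only: ZY)
qed simp_all

section \<open>Cyclic adjacency and the decomposition of the distance matrix\<close>

lemma dvd_cyclic_diff:
  assumes "0 < s" "s \<le> m" "0 < t" "t \<le> m"
  shows "int m dvd int s - int t \<longleftrightarrow> s = t"
    and "int m dvd int s - int t - 1 \<longleftrightarrow> s = next_cyc m t"
    and "int m dvd int s - int t + 1 \<longleftrightarrow> t = next_cyc m s"
proof -
  \<comment> \<open>The half-open window of length \<open>2 * m\<close> contains just two multiples
    of \<open>m\<close>. The value \<open>- m\<close> arises when a successor wraps from
    \<open>m\<close> to 1.\<close>
  have small: "int m dvd x \<longleftrightarrow> x = 0 \<or> x = - int m" if "- int m \<le> x" "x < int m" for x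
  proof
    assume "int m dvd x"
    then obtain q where q: "x = int m * q" by blast
    have "int m > 0" using assms by linarith
    moreover have "int m * (- 1) \<le> int m * q" "int m * q < int m * 1" using that q by simp_all
    ultimately have "- 1 \<le> q" "q < 1" by (simp_all only: mult_le_cancel_left_pos mult_less_cancel_left_pos)
    then have "q = 0 \<or> q = - 1" by linarith
    then show "x = 0 \<or> x = - int m" using q by auto
  qed auto
  show "int m dvd int s - int t \<longleftrightarrow> s = t"
    using small[of "int s - int t"] assms by auto
  show "int m dvd int s - int t - 1 \<longleftrightarrow> s = next_cyc m t"
    using small[of "int s - int t - 1"] assms by (auto simp: next_cyc_def)
  \<comment> \<open>This difference can equal \<open>m\<close>, which lies outside the window, so
    its negative is considered.\<close>
  have "int m dvd int s - int t + 1 \<longleftrightarrow> int m dvd int t - int s - 1"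
    using dvd_minus_iff[of "int m" "int s - int t + 1"] by (simp add: algebra_simps)
  then show "int m dvd int s - int t + 1 \<longleftrightarrow> t = next_cyc m s"
    using small[of "int t - int s - 1"] assms by (auto simp: next_cyc_def)
qed

text \<open>Each distance is \<open>g_i + g_j\<close>, the length of the route through the center,
  less twice the inner product of columns \<open>i\<close> and \<open>j\<close> of \<open>E\<close>.
  The \<open>- 1 / m\<close> in \<open>P\<close> contributes \<open>(2 / m) g g'\<close>, which
  \<open>Y\<close> takes back.\<close>

lemma gear_dist_mat_decomp:
  assumes m: "m \<ge> 3"
  shows "gear_dist_mat (Suc m) =
    (- 2) \<cdot>\<^sub>m (transpose_mat (gear_inc m) * cyc m (cos_mode m 0) * gear_inc m) + block_const m (dist_blocks m)"
    (is "_ = (- 2) \<cdot>\<^sub>m ?M + ?Y")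
proof (rule eq_matI)
  fix i j assume "i < dim_row ((- 2) \<cdot>\<^sub>m ?M + ?Y)" "j < dim_col ((- 2) \<cdot>\<^sub>m ?M + ?Y)"
  then have ij: "i < 2 * m + 1" "j < 2 * m + 1" by (simp_all add: block_const_def)
  have m0: "m > 0" using m by simp
  have shift: "int m dvd x + int m \<longleftrightarrow> int m dvd x" "int m dvd x - int m \<longleftrightarrow> int m dvd x" for x
    using dvd_add_left_iff[of "int m" "- int m" x] by simp_all
  have lhs: "gear_dist_mat (Suc m) $$ (i, j) = real (gear_d m i j)"
    using ij graph_dist_gear[of "Suc m" i j] m by (simp add: gear_dist_mat_def)
  have rhs: "((- 2) \<cdot>\<^sub>m ?M + ?Y) $$ (i, j) = - 2 * ?M $$ (i, j) + dist_blocks m (blk m i) (blk m j)"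
    using ij by (simp add: block_const_def gear_dims)
  let ?R = "of_bool (0 < i \<and> 0 < j) * (of_bool (int m dvd int i - int j) - 1 / real m
      + of_bool (m < j) * (of_bool (int m dvd int i - int j - 1) - 1 / real m)
      + of_bool (m < i) * (of_bool (int m dvd int i - int j + 1) - 1 / real m)
      + of_bool (m < i \<and> m < j) * (of_bool (int m dvd int i - int j) - 1 / real m))"
  have "?M $$ (i, j) = of_bool (0 < i \<and> 0 < j) * (cos_mode m 0 (int i - int j)
      + of_bool (m < j) * cos_mode m 0 (int i - int j - 1) + of_bool (m < i) * cos_mode m 0 (int i - int j + 1)
      + of_bool (m < i \<and> m < j) * cos_mode m 0 (int i - int j))"
    by (rule gear_modes_entry[OF m0 _ ij]) (rule cos_mode_periodic[OF m0])
  also have "\<dots> = ?R" by (simp only: cos_mode_0[OF m0])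
  finally have M: "?M $$ (i, j) = ?R" .
  have i': "i \<le> 2 * m" and j': "j \<le> 2 * m" using ij by auto
  have "real (gear_d m i j) = - 2 * ?R + dist_blocks m (blk m i) (blk m j)"
    using i'
  proof (cases rule: gear_vertex_cases)
    case i: 1
    show ?thesis using j'
      by (cases rule: gear_vertex_cases) (use i m0 in \<open>auto simp: gear_d_simps dist_blocks_def dist_num_def blk_def\<close>)
  next
    case i: 2
    show ?thesis using j'
    proof (cases rule: gear_vertex_cases)
      case 1
      then show ?thesis using i m0 by (simp add: gear_d_simps dist_blocks_def dist_num_def blk_def)
    next
      case j: 2
      then show ?thesis using i m0 dvd_cyclic_diff[of i m j]
        by (simp add: gear_d_simps dist_blocks_def dist_num_def blk_def field_simps)
    next
      case j: (3 t)
      have "int m dvd int i - int j \<longleftrightarrow> i = t" "int m dvd int i - int j - 1 \<longleftrightarrow> i = next_cyc m t"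
        using dvd_cyclic_diff[of i m t] i j shift(2)[of "int i - int t"] shift(2)[of "int i - int t - 1"]
        by (simp_all add: algebra_simps)
      moreover have "t \<noteq> next_cyc m t" using m j by (auto simp: next_cyc_def)
      ultimately show ?thesis using i j m0
        by (auto simp: gear_d_simps dist_blocks_def dist_num_def blk_def field_simps)
    qed
  next
    case i: (3 s)
    show ?thesis using j'
    proof (cases rule: gear_vertex_cases)
      case 1
      then show ?thesis using i m0 by (simp add: gear_d_simps dist_blocks_def dist_num_def blk_def)
    next
      case j: 2
      have "int m dvd int i - int j \<longleftrightarrow> s = j" "int m dvd int i - int j + 1 \<longleftrightarrow> j = next_cyc m s"
        using dvd_cyclic_diff[of s m j] i j shift(1)[of "int s - int j"] shift(1)[of "int s - int j + 1"]
        by (simp_all add: algebra_simps)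
      moreover have "s \<noteq> next_cyc m s" using m i by (auto simp: next_cyc_def)
      ultimately show ?thesis using i j m0
        by (auto simp: gear_d_simps dist_blocks_def dist_num_def blk_def field_simps)
    next
      case j: (3 t)
      have "int m dvd int i - int j \<longleftrightarrow> s = t" "int m dvd int i - int j - 1 \<longleftrightarrow> s = next_cyc m t"
        "int m dvd int i - int j + 1 \<longleftrightarrow> t = next_cyc m s"
        using dvd_cyclic_diff[of s m t] i j by simp_all
      \<comment> \<open>For \<open>m >= 3\<close> two distinct inserted vertices have at most one
        cycle vertex in common, so at most one of the three indicators holds.\<close>
      moreover have "\<not> (s = t \<and> s = next_cyc m t)" "\<not> (s = t \<and> t = next_cyc m s)"
        "\<not> (s = next_cyc m t \<and> t = next_cyc m s)"
        using m i j by (auto simp: next_cyc_def split: if_splits)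
      ultimately show ?thesis using i j m0
        by (auto simp: gear_d_simps dist_blocks_def dist_num_def blk_def field_simps)
    qed
  qed
  then show "gear_dist_mat (Suc m) $$ (i, j) = ((- 2) \<cdot>\<^sub>m ?M + ?Y) $$ (i, j)"
    unfolding lhs rhs M .
qed (auto simp: gear_dist_mat_def block_const_def)

section \<open>Entries of the matrices in the claimed pseudoinverse\<close>

lemma cos_entries_nth:
  assumes "m > 0" "q < m"
  shows "(1 # cos_entries (Suc m) k) ! q = cos (2 * pi * real k * of_int (int q) / real m)"
    and "(cos_entries (Suc m) k @ [1]) ! q = cos (2 * pi * real k * of_int (int q + 1) / real m)"
proof -
  show "(1 # cos_entries (Suc m) k) ! q = cos (2 * pi * real k * of_int (int q) / real m)"
    using assms by (cases q) (simp_all add: cos_entries_def mult_ac)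
  show "(cos_entries (Suc m) k @ [1]) ! q = cos (2 * pi * real k * of_int (int q + 1) / real m)"
  proof (cases "Suc q = m")
    \<comment> \<open>The final entry 1 is \<open>cos (2 * pi * k)\<close>, the value continuing a
      list that starts at multiple 1 instead of 0.\<close>
    case True
    then have "of_int (int q + 1) = real m" by auto
    then have "2 * pi * real k * of_int (int q + 1) / real m = 2 * pi * real k"
      using assms(1) by simp
    moreover have "cos (2 * pi * real k) = 1" using cos_int_2pin[of "int k"] by simp
    ultimately show ?thesis using True by (simp add: cos_entries_def nth_append)
  next
    case False
    then have "q < m - 1" using assms by simp
    then show ?thesis by (simp add: cos_entries_def nth_append mult_ac add.commute)
  qed
qed

text \<open>\<open>circ\<close> reads its list at \<open>j - i\<close> modulo \<open>m\<close>;
  periodicity removes the reduction and evenness of the cosine reverses the sign. The list of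
  \<open>C_tilde\<close> is advanced by one place, which gives
  \<open>j - i + 1 = - (i - j - 1)\<close>.\<close>

lemma C_mat_entry:
  assumes "i < m" "j < m"
  shows "C_mat (Suc m) k $$ (i, j) = cos (2 * pi * real k * of_int (int i - int j) / real m)"
    and "C_tilde (Suc m) k $$ (i, j) = cos (2 * pi * real k * of_int (int i - int j - 1) / real m)"
proof -
  let ?q = "(j + m - i) mod m"
  have m: "m > 0" and q: "?q < m" using assms by auto
  have len: "length (1 # cos_entries (Suc m) k) = m" "length (cos_entries (Suc m) k @ [1]) = m"
    using m by (simp_all add: cos_entries_def)
  have dvd: "int m dvd int ?q - (int j - int i)"
    using int_mod_dvd[of m "j + m - i"] assms
      dvd_add_left_iff[of "int m" "int m" "int ?q - (int j + int m - int i)"]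
    by (simp add: of_nat_diff algebra_simps)
  have neg: "cos (2 * pi * real k * of_int (- d) / real m) = cos (2 * pi * real k * of_int d / real m)" for d
    using cos_minus[of "2 * pi * real k * of_int d / real m"] by simp
  have "C_mat (Suc m) k $$ (i, j) = (1 # cos_entries (Suc m) k) ! ?q"
    unfolding C_mat_def circ_def len using assms by simp
  also have "\<dots> = cos (2 * pi * real k * of_int (int ?q) / real m)" by (rule cos_entries_nth(1)[OF m q])
  also have "\<dots> = cos (2 * pi * real k * of_int (- (int i - int j)) / real m)"
    by (rule cos_circle_periodic[OF m]) (use dvd in simp)
  finally show "C_mat (Suc m) k $$ (i, j) = cos (2 * pi * real k * of_int (int i - int j) / real m)"
    unfolding neg .
  have "C_tilde (Suc m) k $$ (i, j) = (cos_entries (Suc m) k @ [1]) ! ?q"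
    unfolding C_tilde_def circ_def len using assms by simp
  also have "\<dots> = cos (2 * pi * real k * of_int (int ?q + 1) / real m)" by (rule cos_entries_nth(2)[OF m q])
  also have "\<dots> = cos (2 * pi * real k * of_int (- (int i - int j - 1)) / real m)"
    by (rule cos_circle_periodic[OF m]) (use dvd in \<open>simp add: algebra_simps\<close>)
  finally show "C_tilde (Suc m) k $$ (i, j) = cos (2 * pi * real k * of_int (int i - int j - 1) / real m)"
    unfolding neg .
qed

lemma C_mat_carrier:
  "m > 0 \<Longrightarrow> C_mat (Suc m) k \<in> carrier_mat m m" "m > 0 \<Longrightarrow> C_tilde (Suc m) k \<in> carrier_mat m m"
  by (auto simp: C_mat_def C_tilde_def circ_def cos_entries_def)

lemma B_mat_entry:
  fixes m k i j :: nat
  defines "f \<equiv> phi (Suc m) k" and "c \<equiv> \<lambda>d. cos (2 * pi * real k * of_int d / real m)"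
  assumes m: "m > 0" and f: "phi (Suc m) k \<noteq> 0" and ij: "i < 2 * m + 1" "j < 2 * m + 1"
  shows "B_mat (Suc m) k $$ (i, j) = of_bool (0 < i \<and> 0 < j) * (2 / (real m * (1 + 4 * f\<^sup>2)\<^sup>2)) *
    (if m < i \<and> m < j then 4 * f\<^sup>2 * c (int i - int j)
     else c (int i - int j) + of_bool (m < j) * c (int i - int j - 1) + of_bool (m < i) * c (int i - int j + 1))"
proof -
  have f0: "f \<noteq> 0" using f f_def by simp
  let ?C = "C_mat (Suc m) k" and ?C' = "C_tilde (Suc m) k"
  let ?b = "2 / (real m * (2 * f + 1 / (2 * f))\<^sup>2)" and ?b' = "2 / (real m * (1 + 4 * f\<^sup>2)\<^sup>2)"
  \<comment> \<open>The scalar in front is \<open>4 * f^2\<close> times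
    \<open>2 / (m * (1 + 4 * f^2)^2)\<close>. The factor \<open>4 * f^2\<close> cancels in the
    blocks divided by it and survives in the block of inserted vertices.\<close>
  have "2 * f + 1 / (2 * f) = (1 + 4 * f\<^sup>2) / (2 * f)" using f0 by (simp add: field_simps power2_eq_square)
  then have b: "?b = ?b' * (4 * f\<^sup>2)" by (simp add: power_divide power_mult_distrib)
  then have b': "?b * (1 / (4 * f\<^sup>2) * y) = ?b' * y" for y using f0 by simp
  have per: "c (d + int m) = c d" "c (d - int m) = c d" for d
    unfolding c_def by (rule cos_circle_periodic[OF m]; simp)+
  have C: "?C $$ (a, b) = c (int a - int b)" "?C' $$ (a, b) = c (int a - int b - 1)" if "a < m" "b < m" for a b
    using C_mat_entry[OF that] by (simp_all add: c_def)
  have c_minus: "c (- d) = c d" for d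
    using cos_minus[of "2 * pi * real k * of_int d / real m"] by (simp add: c_def)
  have Ct: "transpose_mat ?C' $$ (a, b) = c (int a - int b + 1)" if "a < m" "b < m" for a b
    using C(2)[OF that(2,1)] C_mat_carrier(2)[OF m, of k] that c_minus[of "int a - int b + 1"]
    by (simp add: algebra_simps)
  let ?B = "block3 (0\<^sub>m 1 1) (0\<^sub>m 1 m) (0\<^sub>m 1 m)
     (0\<^sub>m m 1) ((1 / (4 * f\<^sup>2)) \<cdot>\<^sub>m ?C) ((1 / (4 * f\<^sup>2)) \<cdot>\<^sub>m (?C + ?C'))
     (0\<^sub>m m 1) ((1 / (4 * f\<^sup>2)) \<cdot>\<^sub>m (?C + transpose_mat ?C')) ?C"
  note Cc = C_mat_carrier[OF m, of k]
  have carr: "0\<^sub>m 1 1 \<in> carrier_mat 1 1" "0\<^sub>m 1 m \<in> carrier_mat 1 m" "0\<^sub>m 1 m \<in> carrier_mat 1 m"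
    "0\<^sub>m m 1 \<in> carrier_mat m 1" "(1 / (4 * f\<^sup>2)) \<cdot>\<^sub>m ?C \<in> carrier_mat m m"
    "(1 / (4 * f\<^sup>2)) \<cdot>\<^sub>m (?C + ?C') \<in> carrier_mat m m"
    "0\<^sub>m m 1 \<in> carrier_mat m 1" "(1 / (4 * f\<^sup>2)) \<cdot>\<^sub>m (?C + transpose_mat ?C') \<in> carrier_mat m m"
    "?C \<in> carrier_mat m m"
    using Cc by auto
  have ij': "i < 1 + 2 * m" "j < 1 + 2 * m" using ij by auto
  note Be = block3_entry(2)[OF carr ij']
  have "B_mat (Suc m) k $$ (i, j) = ?b * ?B $$ (i, j)"
    using block3_entry(1)[OF carr] ij by (simp add: B_mat_def Let_def f_def)
  also have "\<dots> = of_bool (0 < i \<and> 0 < j) * ?b' *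
    (if m < i \<and> m < j then 4 * f\<^sup>2 * c (int i - int j)
     else c (int i - int j) + of_bool (m < j) * c (int i - int j - 1) + of_bool (m < i) * c (int i - int j + 1))"
  proof -
    have i': "i \<le> 2 * m" and j': "j \<le> 2 * m" using ij by auto
    show ?thesis using i'
    proof (cases rule: gear_vertex_cases)
      case 1
      then show ?thesis unfolding Be using m ij by simp
    next
      case i: 2
      show ?thesis using j'
      proof (cases rule: gear_vertex_cases)
        case 1
        then show ?thesis unfolding Be using i by simp
      next
        case j: 2
        then have "?B $$ (i, j) = 1 / (4 * f\<^sup>2) * c (int i - int j)"
          unfolding Be using i Cc C(1)[of "i - 1" "j - 1"] by (simp add: of_nat_diff)
        then show ?thesis using i j by (simp only: b') simp
      next
        case j: (3 t)
        have "?B $$ (i, j) = 1 / (4 * f\<^sup>2) * (c (int i - int t) + c (int i - int t - 1))"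
          unfolding Be using i j Cc C[of "i - 1" "t - 1"] by (simp add: of_nat_diff)
        moreover have "c (int i - int j) = c (int i - int t)" "c (int i - int j - 1) = c (int i - int t - 1)"
          using per(2)[of "int i - int t"] per(2)[of "int i - int t - 1"] j by (simp_all add: algebra_simps)
        ultimately show ?thesis using i j by (simp only: b') simp
      qed
    next
      case i: (3 s)
      show ?thesis using j'
      proof (cases rule: gear_vertex_cases)
        case 1
        then show ?thesis unfolding Be using i by simp
      next
        case j: 2
        have "?B $$ (i, j) = 1 / (4 * f\<^sup>2) * (c (int s - int j) + c (int s - int j + 1))"
          unfolding Be using i j Cc C(1)[of "s - 1" "j - 1"] Ct[of "s - 1" "j - 1"] by (simp add: of_nat_diff)
        moreover have "c (int i - int j) = c (int s - int j)" "c (int i - int j + 1) = c (int s - int j + 1)"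
          using per(1)[of "int s - int j"] per(1)[of "int s - int j + 1"] i by (simp_all add: algebra_simps)
        ultimately show ?thesis using i j by (simp only: b') simp
      next
        case j: (3 t)
        have "?B $$ (i, j) = c (int i - int j)"
          unfolding Be using i j Cc C(1)[of "s - 1" "t - 1"] by (simp add: of_nat_diff)
        then show ?thesis using i j by (simp only: b) simp
      qed
    qed
  qed
  finally show ?thesis .
qed

lemma cos_pi_int: "cos (pi * of_int d) = (if even d then 1 else - 1)"
  using cos_npi_int[of d] by (simp add: mult.commute)

text \<open>In terms of \<open>cos (pi * d)\<close>, \<open>R\<close> is for even \<open>m\<close>
  the mode of frequency \<open>m / 2\<close>, where \<open>phi\<close> vanishes and the eigenvalue
  is 1.\<close>

lemma H_mat_entry:
  assumes m: "m > 0" and ij: "i < 2 * m + 1" "j < 2 * m + 1"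
  shows "H_mat (Suc m) \<in> carrier_mat (2 * m + 1) (2 * m + 1)"
    and "H_mat (Suc m) $$ (i, j) =
    of_bool (0 < i \<and> i \<le> m \<and> 0 < j \<and> j \<le> m) * cos (pi * of_int (int i - int j)) / real m"
proof -
  have carr: "0\<^sub>m 1 1 \<in> carrier_mat 1 1" "0\<^sub>m 1 m \<in> carrier_mat 1 m" "0\<^sub>m 1 m \<in> carrier_mat 1 m"
    "0\<^sub>m m 1 \<in> carrier_mat m 1" "R_mat (Suc m) \<in> carrier_mat m m"
    "0\<^sub>m m m \<in> carrier_mat m m" "0\<^sub>m m 1 \<in> carrier_mat m 1" "0\<^sub>m m m \<in> carrier_mat m m"
    "0\<^sub>m m m \<in> carrier_mat m m"
    by (auto simp: R_mat_def)
  have ij': "i < 1 + 2 * m" "j < 1 + 2 * m" using ij by auto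
  have "even (i - 1 + (j - 1)) \<longleftrightarrow> even (int i - int j)" if "0 < i" "0 < j"
    using that by presburger
  then have sgn: "(- 1) ^ (i - 1 + (j - 1)) = cos (pi * of_int (int i - int j))" if "0 < i" "0 < j"
    using that by (simp only: cos_pi_int minus_one_power_iff)
  show "H_mat (Suc m) \<in> carrier_mat (2 * m + 1) (2 * m + 1)"
    using block3_entry(1)[OF carr] by (simp add: H_mat_def Let_def)
  show "H_mat (Suc m) $$ (i, j) =
      of_bool (0 < i \<and> i \<le> m \<and> 0 < j \<and> j \<le> m) * cos (pi * of_int (int i - int j)) / real m"
    using block3_entry(1)[OF carr] ij block3_entry(2)[OF carr ij'] sgn
    by (auto simp: H_mat_def Let_def R_mat_def)
qed

text \<open>\<open>A\<close> has rank one: its blocks are products of values of \<open>v_num\<close>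
  over \<open>9 * m^2\<close>, and the scalar in front cancels the 9 and one factor
  \<open>m\<close>.\<close>

lemma A_mat_entry:
  assumes m: "m > 0" and ij: "i < 2 * m + 1" "j < 2 * m + 1"
  shows "A_mat (Suc m) $$ (i, j) = v_num m (blk m i) * v_num m (blk m j) / (real m * (real m + 5)\<^sup>2)"
proof -
  define x where "x = real (Suc m)"
  define a where "a = (x - 2) / (3 * (x - 1))"
  define b where "b = - (x + 1) / (3 * (x - 1))"
  have x: "x - 1 = real m" "x - 2 = real m - 1" "x + 1 = real m + 2" "x + 4 = real m + 5"
    by (simp_all add: x_def)
  have J: "all_ones_mat m = mat m m (\<lambda>_. 1)"
    by (rule eq_matI) (auto simp: all_ones_mat_def ones_def scalar_prod_def)
  let ?e = "ones m" and ?J = "all_ones_mat m"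
  let ?A = "block3 (scalar_mat 1) (a \<cdot>\<^sub>m transpose_mat ?e) (b \<cdot>\<^sub>m transpose_mat ?e)
     (a \<cdot>\<^sub>m ?e) (((x - 2)\<^sup>2 / (9 * (x - 1)\<^sup>2)) \<cdot>\<^sub>m ?J) ((- (x - 2) * (x + 1) / (9 * (x - 1)\<^sup>2)) \<cdot>\<^sub>m ?J)
     (b \<cdot>\<^sub>m ?e) ((- (x - 2) * (x + 1) / (9 * (x - 1)\<^sup>2)) \<cdot>\<^sub>m ?J) (((x + 1)\<^sup>2 / (9 * (x - 1)\<^sup>2)) \<cdot>\<^sub>m ?J)"
  have carr: "scalar_mat 1 \<in> carrier_mat 1 1" "a \<cdot>\<^sub>m transpose_mat ?e \<in> carrier_mat 1 m" "b \<cdot>\<^sub>m transpose_mat ?e \<in> carrier_mat 1 m"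
    "a \<cdot>\<^sub>m ?e \<in> carrier_mat m 1" "((x - 2)\<^sup>2 / (9 * (x - 1)\<^sup>2)) \<cdot>\<^sub>m ?J \<in> carrier_mat m m"
    "(- (x - 2) * (x + 1) / (9 * (x - 1)\<^sup>2)) \<cdot>\<^sub>m ?J \<in> carrier_mat m m"
    "b \<cdot>\<^sub>m ?e \<in> carrier_mat m 1" "(- (x - 2) * (x + 1) / (9 * (x - 1)\<^sup>2)) \<cdot>\<^sub>m ?J \<in> carrier_mat m m"
    "((x + 1)\<^sup>2 / (9 * (x - 1)\<^sup>2)) \<cdot>\<^sub>m ?J \<in> carrier_mat m m"
    by (auto simp: scalar_mat_def ones_def J)
  have ij': "i < 1 + 2 * m" "j < 1 + 2 * m" using ij by auto
  have "?A $$ (i, j) = v_num m (blk m i) * v_num m (blk m j) / (9 * (real m)\<^sup>2)"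
    unfolding block3_entry(2)[OF carr ij'] using m ij
    by (auto simp: blk_def v_num_def scalar_mat_def ones_def J a_def b_def x_def power2_eq_square field_simps)
  moreover have "A_mat (Suc m) = (9 * (x - 1) / (x + 4)\<^sup>2) \<cdot>\<^sub>m ?A"
    by (simp only: A_mat_def Let_def a_def b_def x_def diff_Suc_1)
  then have "A_mat (Suc m) $$ (i, j) = 9 * real m / (real m + 5)\<^sup>2 * ?A $$ (i, j)"
    using block3_entry(1)[OF carr] ij' by (simp only: x carrier_matD index_smult_mat)
  ultimately show ?thesis using m by (simp add: power2_eq_square)
qed

lemma u_vec_entry:
  assumes m: "m > 0"
  shows "u_vec (Suc m) \<in> carrier_mat (2 * m + 1) 1"
    and "i < 2 * m + 1 \<Longrightarrow> u_vec (Suc m) $$ (i, 0) = u_num m (blk m i) / (real m * (real m + 5))"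
proof -
  \<comment> \<open>The factorization \<open>(n - 1) * (n + 4)\<close> puts all three blocks of
    \<open>u\<close> over the same denominator.\<close>
  have q: "(real (Suc m))\<^sup>2 + 3 * real (Suc m) - 4 = real m * (real m + 5)"
    by (simp add: power2_eq_square algebra_simps)
  show "u_vec (Suc m) \<in> carrier_mat (2 * m + 1) 1"
    by (auto simp: u_vec_def Let_def scalar_mat_def ones_def append_rows_def)
  assume "i < 2 * m + 1"
  then consider "i = 0" | "0 < i" "i \<le> m" "i - 1 < m" | "m < i" "\<not> i - 1 < m" "i - 1 - m < m"
    using m by fastforce
  then show "u_vec (Suc m) $$ (i, 0) = u_num m (blk m i) / (real m * (real m + 5))"
    unfolding u_vec_def Let_def q using m
    by cases (auto simp: u_num_def blk_def scalar_mat_def ones_def append_rows_def)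
qed

section \<open>Comparison of \<open>L_odd\<close> with the Fourier form\<close>

lemma cos_mode_fold:
  assumes q: "q > 0"
  shows "cos_mode (2 * q) s d = ((\<Sum>k = 1..q - 1. 2 * cos (2 * pi * real k * of_int d / real (2 * q))
     / (1 + 4 * (phi (Suc (2 * q)) k)\<^sup>2) ^ s) + cos (pi * of_int d)) / real (2 * q)"
proof -
  define m where "m = 2 * q"
  define h where "h k = cos (2 * pi * real k * of_int d / real m) / (3 + 2 * cos (2 * pi * real k / real m)) ^ s" for k
  have m: "m > 0" using q m_def by simp
  \<comment> \<open>Frequencies \<open>k\<close> and \<open>m - k\<close> agree at integer points,
    so with \<open>m = 2 * q\<close> only \<open>q\<close> stays unpaired. The case
    \<open>e = 1\<close> covers the eigenvalue.\<close>
  have refl_cos: "cos (2 * pi * real (m - k) * of_int e / real m) = cos (2 * pi * real k * of_int e / real m)"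
    if "k \<le> m" for k e
  proof -
    have "2 * pi * real (m - k) * of_int e / real m = 2 * pi * of_int e - 2 * pi * real k * of_int e / real m"
      using that m by (simp add: of_nat_diff field_simps)
    then show ?thesis by (simp add: cos_diff sin_int_2pin cos_int_2pin)
  qed
  have h_refl: "h (m - k) = h k" if "k \<le> m" for k
    using refl_cos[OF that, of d] refl_cos[OF that, of 1] by (simp add: h_def)
  have split: "{1..<m} = {1..q - 1} \<union> {q} \<union> {q + 1..<m}" using q m_def by auto
  have "(\<Sum>k = q + 1..<m. h k) = (\<Sum>k = 1..q - 1. h k)"
    by (rule sum.reindex_bij_witness[of _ "\<lambda>k. m - k" "\<lambda>k. m - k"])
       (use q m_def h_refl in auto)
  moreover have "(\<Sum>k = 1..<m. h k) = (\<Sum>k = 1..q - 1. h k) + h q + (\<Sum>k = q + 1..<m. h k)"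
    unfolding split by (subst sum.union_disjoint; (subst sum.union_disjoint)?) (use q in auto)
  ultimately have sum_h: "(\<Sum>k = 1..<m. h k) = (\<Sum>k = 1..q - 1. 2 * h k) + h q"
    by (simp add: sum_distrib_left[symmetric])
  \<comment> \<open>At the middle frequency the eigenvalue \<open>3 + 2 * cos pi\<close> is 1, so
    the exponent \<open>s\<close> drops out.\<close>
  have h_q: "h q = cos (pi * of_int d)"
  proof -
    have "2 * pi * real q * of_int d / real m = pi * of_int d" "2 * pi * real q / real m = pi"
      using q by (simp_all add: m_def)
    then show ?thesis by (simp only: h_def cos_pi) simp
  qed
  have h_k: "2 * h k = 2 * cos (2 * pi * real k * of_int d / real m) / (1 + 4 * (phi (Suc m) k)\<^sup>2) ^ s" for k
  proof -
    have "2 * pi * real k / real m = 2 * (pi * real k / real m)" by simp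
    then have "3 + 2 * cos (2 * pi * real k / real m) = 1 + 4 * (phi (Suc m) k)\<^sup>2"
      by (simp only: cos_double_cos) (simp add: phi_def)
    then show ?thesis unfolding h_def by (simp only: times_divide_eq_right)
  qed
  show ?thesis
    using sum_h[unfolded h_q h_k] unfolding m_def[symmetric] cos_mode_def h_def[symmetric] by (simp only:)
qed

lemma phi_pos:
  assumes "2 * k < m"
  shows "phi (Suc m) k > 0"
proof -
  have "pi * (2 * real k) < pi * real m" using assms by (intro mult_strict_left_mono) auto
  then have "pi * real k / real m < pi / 2" using assms by (simp add: field_simps)
  moreover have "- (pi / 2) < pi * real k / real m" by (rule less_le_trans[of _ 0]) simp_all
  ultimately show ?thesis by (simp add: phi_def cos_gt_zero_pi)
qed

text \<open>Unless both vertices are inserted, \<open>B_k\<close> gives the exponent 2 terms of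
  \<open>E' K E\<close> directly. For two inserted vertices, \<open>4 * phi^2 = lam - 1\<close>
  splits the coefficient into exponents 1 and 2, and \<open>cos_mode_Suc\<close> matches the two
  sides. \<open>H\<close> supplies the middle frequency.\<close>

lemma L_odd_entry:
  assumes m: "m = 2 * q" and q: "q > 0" and ij: "i < 2 * m + 1" "j < 2 * m + 1"
  shows "L_odd (Suc m) $$ (i, j) =
    (transpose_mat (gear_inc m) * cyc m (cos_mode m 2) * gear_inc m) $$ (i, j)
    + v_num m (blk m i) * v_num m (blk m j) / (real m * (real m + 5)\<^sup>2)"
proof -
  have m0: "m > 0" using m q by simp
  define d where "d = int i - int j"
  define lam where "lam k = 1 + 4 * (phi (Suc m) k)\<^sup>2" for k
  define c where "c k e = cos (2 * pi * real k * of_int e / real m)" for k and e :: int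
  define G where "G s e = (\<Sum>k = 1..q - 1. 2 / (real m * lam k ^ s) * c k e)" for s e
  have lam: "lam k > 0" for k unfolding lam_def by (intro add_pos_nonneg) auto
  have mode: "cos_mode m s e = G s e + cos (pi * of_int e) / real m" for s e
    using cos_mode_fold[OF q, of s e, folded m, folded lam_def c_def]
    by (simp add: G_def add_divide_distrib sum_divide_distrib mult_ac)
  have B: "B_mat (Suc m) k $$ (i, j) = of_bool (0 < i \<and> 0 < j) * (2 / (real m * lam k ^ 2)) *
    (if m < i \<and> m < j then (lam k - 1) * c k d
     else c k d + of_bool (m < j) * c k (d - 1) + of_bool (m < i) * c k (d + 1))" if "k \<in> {1..q - 1}" for k
  proof -
    have "2 * k < m" using that q m by auto
    then have "phi (Suc m) k \<noteq> 0" using phi_pos by fastforce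
    moreover have "4 * (phi (Suc m) k)\<^sup>2 = lam k - 1" by (simp add: lam_def)
    ultimately show ?thesis
      using B_mat_entry[OF m0 _ ij, of k] unfolding lam_def[symmetric] c_def[symmetric] d_def[symmetric]
      by (simp only: simp_thms)
  qed
  have sumB: "(\<Sum>k = 1..q - 1. B_mat (Suc m) k $$ (i, j)) = of_bool (0 < i \<and> 0 < j) *
     (if m < i \<and> m < j then G 1 d - G 2 d
      else G 2 d + of_bool (m < j) * G 2 (d - 1) + of_bool (m < i) * G 2 (d + 1))"
  proof (cases "m < i \<and> m < j")
    case True
    have "2 / (real m * lam k ^ 2) * ((lam k - 1) * c k d)
        = 2 / (real m * lam k ^ 1) * c k d - 2 / (real m * lam k ^ 2) * c k d" for k
      using lam[of k] m0 by (simp add: field_simps power2_eq_square)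
    then have "(\<Sum>k = 1..q - 1. B_mat (Suc m) k $$ (i, j)) = (\<Sum>k = 1..q - 1.
        2 / (real m * lam k ^ 1) * c k d - 2 / (real m * lam k ^ 2) * c k d)"
      using True by (intro sum.cong) (simp_all add: B)
    then show ?thesis using True by (simp add: G_def sum_subtractf)
  next
    case False
    have "(\<Sum>k = 1..q - 1. B_mat (Suc m) k $$ (i, j)) = (\<Sum>k = 1..q - 1.
       of_bool (0 < i \<and> 0 < j) * (2 / (real m * lam k ^ 2) * c k d
       + of_bool (m < j) * (2 / (real m * lam k ^ 2) * c k (d - 1))
       + of_bool (m < i) * (2 / (real m * lam k ^ 2) * c k (d + 1))))"
      using False by (intro sum.cong) (auto simp: B distrib_left add_divide_distrib)
    then show ?thesis
      using False by (simp add: G_def sum.distrib sum_distrib_left[symmetric] del: sum_of_bool_mult_eq sum_mult_of_bool_eq)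
  qed
  have M: "(transpose_mat (gear_inc m) * cyc m (cos_mode m 2) * gear_inc m) $$ (i, j) =
    of_bool (0 < i \<and> 0 < j) * (cos_mode m 2 d + of_bool (m < j) * cos_mode m 2 (d - 1)
      + of_bool (m < i) * cos_mode m 2 (d + 1) + of_bool (m < i \<and> m < j) * cos_mode m 2 d)"
    unfolding d_def by (rule gear_modes_entry[OF m0 _ ij]) (rule cos_mode_periodic[OF m0])
  have "3 * cos_mode m 2 d + cos_mode m 2 (d - 1) + cos_mode m 2 (d + 1) = cos_mode m 1 d"
    using cos_mode_Suc[of m 1 d] by (simp add: numeral_2_eq_2)
  \<comment> \<open>The middle frequency does not depend on the exponent and cancels in the
    difference, in agreement with the zero block of \<open>H\<close> for inserted vertices.\<close>
  then have both: "cos_mode m 2 d + cos_mode m 2 (d - 1) + cos_mode m 2 (d + 1) + cos_mode m 2 d = G 1 d - G 2 d"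
    unfolding mode by (simp add: algebra_simps)
  have "(n - 3) div 2 = q - 1" if "n = Suc m" for n using that m q by simp
  then have "L_odd (Suc m) $$ (i, j) = A_mat (Suc m) $$ (i, j) + H_mat (Suc m) $$ (i, j)
      + (\<Sum>k = 1..q - 1. B_mat (Suc m) k $$ (i, j))"
    using ij H_mat_entry(1)[OF m0 ij] by (simp add: L_odd_def)
  moreover have "H_mat (Suc m) $$ (i, j) + (\<Sum>k = 1..q - 1. B_mat (Suc m) k $$ (i, j)) =
      (transpose_mat (gear_inc m) * cyc m (cos_mode m 2) * gear_inc m) $$ (i, j)"
  proof (cases "m < i \<and> m < j")
    case True
    then show ?thesis unfolding sumB M H_mat_entry(2)[OF m0 ij] using both by simp
  next
    case False
    \<comment> \<open>Adjacent values of the alternating mode cancel, in agreement with the zero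
      blocks of \<open>H\<close> between cycle and inserted vertices.\<close>
    have "cos (pi * of_int (e - 1)) = - cos (pi * of_int e)" "cos (pi * of_int (e + 1)) = - cos (pi * of_int e)" for e :: int
      unfolding cos_pi_int by auto
    then show ?thesis unfolding sumB M H_mat_entry(2)[OF m0 ij] mode d_def[symmetric]
      using False by (auto simp: not_less)
  qed
  ultimately show ?thesis unfolding A_mat_entry[OF m0 ij] by simp
qed

section \<open>Assembly of the pseudoinverse\<close>

theorem theorem5:
  fixes n :: nat
  assumes "n \<ge> 5" and "odd n"
  shows "pinv (gear_dist_mat n) =
    (- 1 / 2) \<cdot>\<^sub>m L_odd n + ((real n - 1) / 2) \<cdot>\<^sub>m (u_vec n * transpose_mat (u_vec n))"
proof -
  obtain q where n: "n = Suc (2 * q)" using assms(2) by (auto elim: oddE)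
  define m where "m = 2 * q"
  have nm: "n = Suc m" and q: "q > 0" and m3: "m \<ge> 3" and m0: "m > 0"
    using assms(1) n by (auto simp: m_def)
  define N where "N = 2 * m + 1"
  let ?S = "\<lambda>s. transpose_mat (gear_inc m) * cyc m (cos_mode m s) * gear_inc m"
  let ?Y = "block_const m (dist_blocks m)" and ?Z = "block_const m (pinv_blocks m)"
  have Sc: "?S s \<in> carrier_mat N N" for s
    unfolding N_def by (intro mult_carrier_mat[of _ _ m]) auto
  have Bc: "block_const m f \<in> carrier_mat N N" for f unfolding N_def by simp
  have S_sym: "transpose_mat (?S s) = ?S s" for s
  proof -
    let ?E = "gear_inc m" and ?C = "cyc m (cos_mode m s)"
    have T: "transpose_mat ?E \<in> carrier_mat N m" and TC: "transpose_mat ?E * ?C \<in> carrier_mat N m"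
      unfolding N_def by (auto intro: mult_carrier_mat[of _ _ m])
    show ?thesis
      using transpose_mult[OF TC gear_carriers(2)[of m, folded N_def]] transpose_mult[OF T gear_carriers(1)[of m]]
        assoc_mult_mat[OF T gear_carriers(1)[of m] gear_carriers(2)[of m, folded N_def]]
      by (simp add: transpose_cyc_cos_mode)
  qed
  have Y_sym: "transpose_mat ?Y = ?Y" and Z_sym: "transpose_mat ?Z = ?Z"
    by (rule transpose_dist_pinv_blocks)+
  have SB: "?S s * block_const m f = 0\<^sub>m N N" for s f
    unfolding N_def by (rule gear_modes_mult_block_const[OF m0])
  \<comment> \<open>The transpose of the previous fact, both factors being symmetric.\<close>
  have BS: "block_const m f * ?S s = 0\<^sub>m N N" if "transpose_mat (block_const m f) = block_const m f" for s f
    using arg_cong[OF SB[of s f], of transpose_mat] transpose_mult[OF Sc Bc, of s f] S_sym that by simp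
  have "penrose_conditions ((- 2) \<cdot>\<^sub>m ?S 0 + ?Y) ((1 / - 2) \<cdot>\<^sub>m ?S 2 + ?Z)"
  proof (rule penrose_add_orthogonal[of _ N])
    show "penrose_conditions ((- 2) \<cdot>\<^sub>m ?S 0) ((1 / - 2) \<cdot>\<^sub>m ?S 2)"
      by (rule penrose_smult[OF penrose_gear_modes[OF m0]]) simp
    show "penrose_conditions ?Y ?Z" by (rule penrose_dist_blocks[OF m0])
    have zero: "c \<cdot>\<^sub>m 0\<^sub>m N N = 0\<^sub>m N N" for c :: real by (rule eq_matI) auto
    show "(- 2) \<cdot>\<^sub>m ?S 0 * ?Z = 0\<^sub>m N N" "(1 / - 2) \<cdot>\<^sub>m ?S 2 * ?Y = 0\<^sub>m N N"
      by (simp_all only: mult_smult_assoc_mat[OF Sc Bc] SB zero)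
    show "?Z * ((- 2) \<cdot>\<^sub>m ?S 0) = 0\<^sub>m N N" "?Y * ((1 / - 2) \<cdot>\<^sub>m ?S 2) = 0\<^sub>m N N"
      by (simp_all only: mult_smult_distrib[OF Bc Sc] BS Y_sym Z_sym zero)
  qed (use Sc Bc in auto)
  then have "pinv (gear_dist_mat n) = (1 / - 2) \<cdot>\<^sub>m ?S 2 + ?Z"
    unfolding nm gear_dist_mat_decomp[OF m3] by (rule pinv_eqI)
  also have "\<dots> = (- 1 / 2) \<cdot>\<^sub>m L_odd n + ((real n - 1) / 2) \<cdot>\<^sub>m (u_vec n * transpose_mat (u_vec n))"
    (is "?L = ?R")
  proof (rule eq_matI)
    note u = u_vec_entry(1)[OF m0]
    show "dim_row ?L = dim_row ?R" "dim_col ?L = dim_col ?R"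
      using u unfolding nm by (simp_all add: block_const_def)
    fix i j assume "i < dim_row ?R" "j < dim_col ?R"
    then have ij: "i < 2 * m + 1" "j < 2 * m + 1" using u unfolding nm by simp_all
    have uu: "(u_vec n * transpose_mat (u_vec n)) $$ (i, j)
        = u_num m (blk m i) * u_num m (blk m j) / (real m * (real m + 5))\<^sup>2"
    proof -
      have "(u_vec n * transpose_mat (u_vec n)) $$ (i, j) = (\<Sum>a<1. u_vec n $$ (i, a) * transpose_mat (u_vec n) $$ (a, j))"
        by (rule mult_mat_entry[of _ "2 * m + 1" _ _ "2 * m + 1"]) (use u ij nm in auto)
      then show ?thesis
        using u ij u_vec_entry(2)[OF m0] nm by (simp add: power2_eq_square)
    qed
    have L: "dim_row (L_odd n) = 2 * m + 1" "dim_col (L_odd n) = 2 * m + 1"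
      unfolding L_odd_def nm by simp_all
    have "?L $$ (i, j) = - 1 / 2 * ?S 2 $$ (i, j) + pinv_blocks m (blk m i) (blk m j)"
      using ij carrier_matD[OF Sc[of 2]] unfolding N_def by (simp add: block_const_def gear_dims)
    also have "\<dots> = - 1 / 2 * L_odd n $$ (i, j) + (real n - 1) / 2 * (u_vec n * transpose_mat (u_vec n)) $$ (i, j)"
    proof -
      have "pinv_blocks m (blk m i) (blk m j) =
          - 1 / 2 * (v_num m (blk m i) * v_num m (blk m j) / (real m * (real m + 5)\<^sup>2))
          + real m / 2 * (u_num m (blk m i) * u_num m (blk m j) / (real m * (real m + 5))\<^sup>2)"
        using m0 by (simp add: pinv_blocks_def pinv_num_def power_mult_distrib diff_divide_distrib power2_eq_square mult_ac)
      then show ?thesis unfolding uu unfolding nm L_odd_entry[OF m_def q ij] by (simp add: algebra_simps)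
    qed
    also have "\<dots> = ?R $$ (i, j)"
      using ij L u unfolding nm by simp
    finally show "?L $$ (i, j) = ?R $$ (i, j)" .
  qed
  finally show ?thesis .
qed

end
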